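(* Let $a\in L^\infty(I\times I,[0,1])$ and let $\mathcal{A}$ be the adjacency operator on $L^2(I,\mathbb{R}^d)$ defined by $(\mathcal{A}x)(i):=\int_I a(i,j)x(j)\,\mathrm{d}j$. Assume that $\mathcal{A}$ is symmetric ($\mathcal{A}=\mathcal{A}^*$), and let $\mathbb{L}$ be the corresponding graph-Laplacian. Then the interaction topology described by $\mathcal{A}$ is strongly connected if and only if $\lambda_2(\mathbb{L})>0$.
   Context: $I:=[0,1]$ with the Lebesgue measure, $d\geq 1$ is an integer. Graph-Laplacian: $(\mathbb{L}x)(i):=\int_I a(i,j)(x(i)-x(j))\,\mathrm{d}j$ for $x\in L^2(I,\mathbb{R}^d)$. Algebraic connectivity: with $\mathscr{C}\subset L^2(I,\mathbb{R}^d)$ the subspace of constant functions, so that $\mathscr{C}^\perp=\{x\in L^2(I,\mathbb{R}^d):\int_I x(i)\,\mathrm{d}i=0\}$, $$\lambda_2(\mathbb{L}):=\inf_{x\in\mathscr{C}^\perp\setminus\{0\}}\frac{\langle\mathbb{L}x,x\rangle_{L^2(I,\mathbb{R}^d)}}{\|x\|_{L^2(I,\mathbb{R}^d)}^2} .$$ Strong connectivity: the interaction topology described by $\mathcal{A}$ (with kernel $a$) is strongly connected if the following two conditions hold. (a) For almost every $i\in I$ and for each Lebesgue point $j\in I\setminus\{i\}$ of $a(i,\cdot)\in L^\infty(I,[0,1])$, there exist an integer $m\geq1$ and a finite sequence $(l_k)_{1\leq k\leq m}\subset I$ satisfying $i=l_1$, $j=l_m$ and such that $l_{k+1}\in\mathrm{supp}(a(l_k,\cdot))$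 is a Lebesgue point of $a(l_k,\cdot)$ for each $k\in\{1,\dots,m-1\}$. (b) $\operatorname{ess\,inf}_{i\in I}\int_I a(i,j)\,\mathrm{d}j>0$.
   Formalization: Strong connectivity (a) is read up to null sets: for every null set some larger null set N can be removed so that i, the endpoint j and all l_k lie in I∖N; supp a(i,·) means the set where a(i,·) is nonzero, not the closed support. Taken literally, the equivalence is false. *)

theory Defs
  imports "HOL-Analysis.Analysis"
begin

abbreviation lebI :: "real measure"
  where "lebI \<equiv> lebesgue_on {0..1}"

text \<open>Elements of \<open>L\<^sup>2(I, \<real>\<^sup>d)\<close> are represented by functions; being zero in \<open>L\<^sup>2\<close> means being zero
  almost everywhere.\<close>

definition L2I :: "(real \<Rightarrow> real ^ 'd) set"
  where "L2I = {x. x \<in> borel_measurable lebI \<and> integrable lebI (\<lambda>i. (norm (x i))\<^sup>2)}"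

definition innerL2 :: "(real \<Rightarrow> real ^ 'd) \<Rightarrow> (real \<Rightarrow> real ^ 'd) \<Rightarrow> real"
  where "innerL2 x y = (LINT i|lebI. x i \<bullet> y i)"

definition normL2 :: "(real \<Rightarrow> real ^ 'd) \<Rightarrow> real"
  where "normL2 x = sqrt (LINT i|lebI. (norm (x i))\<^sup>2)"

definition const_space :: "(real \<Rightarrow> real ^ 'd) set"
  where "const_space = {x \<in> L2I. \<exists>c. AE i in lebI. x i = c}"

definition const_perp :: "(real \<Rightarrow> real ^ 'd) set"
  where "const_perp = {x \<in> L2I. \<forall>y \<in> const_space. innerL2 x y = 0}"

definition adjacency :: "(real \<times> real \<Rightarrow> real) \<Rightarrow> (real \<Rightarrow> real ^ 'd) \<Rightarrow> real \<Rightarrow> real ^ 'd"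
  where "adjacency a x i = (LINT j|lebI. a (i, j) *\<^sub>R x j)"

definition graph_laplacian :: "(real \<times> real \<Rightarrow> real) \<Rightarrow> (real \<Rightarrow> real ^ 'd) \<Rightarrow> real \<Rightarrow> real ^ 'd"
  where "graph_laplacian a x i = (LINT j|lebI. a (i, j) *\<^sub>R (x i - x j))"

definition symmetric_op :: "((real \<Rightarrow> real ^ 'd) \<Rightarrow> real \<Rightarrow> real ^ 'd) \<Rightarrow> bool"
  where "symmetric_op T \<longleftrightarrow> (\<forall>x \<in> L2I. \<forall>y \<in> L2I. innerL2 (T x) y = innerL2 x (T y))"

definition lambda2 :: "((real \<Rightarrow> real ^ 'd) \<Rightarrow> real \<Rightarrow> real ^ 'd) \<Rightarrow> real"
  where "lambda2 T =
    (INF x \<in> {x \<in> const_perp. \<not> (AE i in lebI. x i = 0)}. innerL2 (T x) x / (normL2 x)\<^sup>2)"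

definition ess_inf :: "'a measure \<Rightarrow> ('a \<Rightarrow> real) \<Rightarrow> ereal"
  where "ess_inf M f = Liminf (ae_filter M) (\<lambda>x. ereal (f x))"

definition lebesgue_point :: "(real \<Rightarrow> real) \<Rightarrow> real \<Rightarrow> bool"
  where "lebesgue_point f j \<longleftrightarrow> j \<in> {0..1} \<and> integrable lebI f \<and>
    ((\<lambda>r. (LINT y|lebesgue_on ({0..1} \<inter> cball j r). \<bar>f y - f j\<bar>)
            / measure lebesgue ({0..1} \<inter> cball j r)) \<longlongrightarrow> 0) (at_right 0)"

text \<open>The chain condition, with all indices taken in \<open>J\<close>. The support of \<open>a(i, \<cdot>)\<close> is the set where it
  is nonzero; its values are only tested at Lebesgue points. A topological support would not do:
  if \<open>S\<close> is open and dense with \<open>0 < |S| < 1\<close>, and \<open>a\<close> is \<open>1\<close> on \<open>S \<times> S\<close> and on its counterpart for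
  the complement, and \<open>0\<close> elsewhere, then all of \<open>I\<close> is in the topological support of each
  \<open>a(i, \<cdot>)\<close> with \<open>i \<in> S\<close>, although no edge leaves \<open>S\<close>.\<close>

definition chain_connected_on :: "real set \<Rightarrow> (real \<times> real \<Rightarrow> real) \<Rightarrow> bool"
  where "chain_connected_on J a \<longleftrightarrow>
    (AE i in lebesgue_on J. \<forall>j \<in> J - {i}. lebesgue_point (\<lambda>y. a (i, y)) j \<longrightarrow>
      (\<exists>m \<ge> (1::nat). \<exists>l :: nat \<Rightarrow> real.
         (\<forall>k \<in> {1..m}. l k \<in> J) \<and> l 1 = i \<and> l m = j \<and>
         (\<forall>k \<in> {1..<m}. l (k + 1) \<in> support_on {0..1} (\<lambda>y. a (l k, y)) \<and>
                         lebesgue_point (\<lambda>y. a (l k, y)) (l (k + 1)))))"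

text \<open>As an element of \<open>L\<^sup>\<infinity>(I \<times> I)\<close>, \<open>a\<close> has sections \<open>a(l, \<cdot>)\<close> only for almost every \<open>l\<close>, whereas a
  chain visits individual points. The chain condition is therefore understood up to null sets:
  any prescribed null set can be discarded from \<open>I\<close>, possibly after enlarging it to another null
  set. This makes the notion independent of the representative \<open>a\<close>; asking the chain condition only
  for \<open>J = I\<close> would not, since altering a single section \<open>a(l, \<cdot>)\<close> can create chains. Nor can
  the endpoint \<open>j\<close> range over all Lebesgue points of \<open>a(i, \<cdot>)\<close>: \<open>a(i, \<cdot>)\<close> may vanish near \<open>j\<close>
  for a set of \<open>i\<close> of positive measure while \<open>j\<close> is a jump of every \<open>a(l, \<cdot>)\<close> that does not
  vanish near \<open>j\<close>, so that no chain whatsoever ends in \<open>j\<close>, however well connected \<open>a\<close> is.\<close>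

definition strongly_connected :: "(real \<times> real \<Rightarrow> real) \<Rightarrow> bool"
  where "strongly_connected a \<longleftrightarrow>
    (\<forall>N\<^sub>0 \<in> null_sets lebesgue. \<exists>N \<in> null_sets lebesgue. N\<^sub>0 \<subseteq> N \<and> chain_connected_on ({0..1} - N) a) \<and>
    ess_inf lebI (\<lambda>i. LINT j|lebI. a (i, j)) > 0"

lemma L2I_integrable:
  assumes "x \<in> L2I"
  shows "integrable lebI x"
proof (rule Bochner_Integration.integrable_bound)
  show "integrable lebI (\<lambda>i. 1 + (norm (x i))\<^sup>2)"
  proof (rule Bochner_Integration.integrable_add)
    show "integrable lebI (\<lambda>i. 1 :: real)"
      by (rule finite_measure.integrable_const) (rule finite_measure_lebesgue_on, simp)
    show "integrable lebI (\<lambda>i. (norm (x i))\<^sup>2)"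
      using assms by (simp add: L2I_def)
  qed
  show "x \<in> borel_measurable lebI" using assms by (auto simp: L2I_def)
  have "t \<le> 1 + t\<^sup>2" for t :: real
  proof -
    have "0 \<le> (t - 1/2)\<^sup>2 + 3/4" by simp
    then show ?thesis by (simp add: power2_eq_square algebra_simps)
  qed
  then show "AE i in lebI. norm (x i) \<le> norm (1 + (norm (x i))\<^sup>2)"
    by (simp add: abs_of_nonneg)
qed

lemma const_perp_eq: "const_perp = {x \<in> L2I. (LINT i|lebI. x i) = 0}"
proof -
  have inner_const: "innerL2 x y = (LINT i|lebI. x i) \<bullet> c"
    if "x \<in> L2I" "y \<in> L2I" "AE i in lebI. y i = c" for x y :: "real \<Rightarrow> real ^ 'd" and c
  proof -
    have [measurable]: "x \<in> borel_measurable lebI" "y \<in> borel_measurable lebI"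
      using that by (auto simp: L2I_def)
    have "innerL2 x y = (LINT i|lebI. x i \<bullet> c)"
      unfolding innerL2_def by (rule integral_cong_AE) (use that(3) in auto)
    also have "\<dots> = (LINT i|lebI. x i) \<bullet> c"
      using L2I_integrable[OF that(1)] by simp
    finally show ?thesis .
  qed
  have const: "(\<lambda>_. c) \<in> const_space" for c :: "real ^ 'd"
  proof -
    have "integrable lebI (\<lambda>i. (norm c)\<^sup>2)"
      by (rule finite_measure.integrable_const) (rule finite_measure_lebesgue_on, simp)
    then show ?thesis
      unfolding const_space_def L2I_def by auto
  qed
  show ?thesis
  proof (intro set_eqI iffI)
    fix x :: "real \<Rightarrow> real ^ 'd" assume x: "x \<in> const_perp"
    let ?c = "LINT i|lebI. x i"
    have "innerL2 x (\<lambda>_. ?c) = 0" "x \<in> L2I"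
      using x const by (auto simp: const_perp_def)
    then have "?c \<bullet> ?c = 0"
      using inner_const[of x "\<lambda>_. ?c" ?c] const[of ?c] by (auto simp: const_space_def)
    then show "x \<in> {x \<in> L2I. (LINT i|lebI. x i) = 0}" using \<open>x \<in> L2I\<close> by simp
  next
    fix x :: "real \<Rightarrow> real ^ 'd" assume "x \<in> {x \<in> L2I. (LINT i|lebI. x i) = 0}"
    then show "x \<in> const_perp"
      unfolding const_perp_def const_space_def
      by clarify (simp add: inner_const)
  qed
qed

end

theory Submission
  imports Defs "HOL-Probability.Probability_Measure" "HOL-Complex_Analysis.Great_Picard"
begin

text \<open>Up to a null set \<open>a\<close> is a symmetric Borel kernel \<open>w\<close>, and both sides of the equivalence turn out to
  say that the degree function is bounded away from \<open>0\<close> and that \<open>w\<close> is irreducible: \<open>w = 0\<close> almost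
  everywhere on \<open>S \<times> S\<^sup>c\<close> only if \<open>S\<close> is null or conull.

  On the spectral side, \<open>\<langle>\<bbbL>x, x\<rangle>\<close> is half the energy \<open>\<integral>\<integral> w(i, j) |x(i) - x(j)|\<^sup>2\<close>, so centred indicators bound
  \<open>\<lambda>\<^sub>2\<close> by cuts and degrees. Conversely, if \<open>\<lambda>\<^sub>2 \<le> 0\<close>, there are normalised \<open>y\<^sub>n \<in> \<C>\<^sup>\<bottom>\<close> whose energy tends
  to \<open>0\<close>; then \<open>\<bbbL>y\<^sub>n = deg y\<^sub>n - \<A>y\<^sub>n\<close> tends to \<open>0\<close>, a subsequence of \<open>\<A>y\<^sub>n\<close> converges because \<open>\<A>\<close> is compact,
  and dividing by the degree gives a strong limit of the \<open>y\<^sub>n\<close>. It has mean \<open>0\<close>, norm \<open>1\<close> and energy \<open>0\<close>, which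
  irreducibility forbids.

  On the combinatorial side, a chain leaving \<open>S\<close> must enter \<open>S\<^sup>c\<close> at a Lebesgue point of a section vanishing
  on \<open>S\<^sup>c\<close>, which is impossible at density points of \<open>S\<^sup>c\<close>. Conversely, the measurable sets \<open>T\<^sub>0\<close>, \<open>T\<^sub>1\<close>, \<dots>
  of points with positive in-flow from the previous one consist of points reachable from \<open>i\<close>; no mass of \<open>w\<close>
  leaves their union, which is therefore conull.\<close>

section \<open>Complete measures, Fubini and Cauchy-Schwarz\<close>

lemma complete_measure_lebesgue_on:
  assumes "S \<in> sets lebesgue"
  shows "complete_measure (lebesgue_on S)"
proof
  fix A B assume "B \<subseteq> A" "A \<in> null_sets (lebesgue_on S)"
  then have "A \<subseteq> S" "A \<in> null_sets lebesgue"
    using assms by (auto simp: null_sets_restrict_space)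
  then have "B \<subseteq> S" "B \<in> null_sets lebesgue"
    using \<open>B \<subseteq> A\<close> completion.complete2 by blast+
  then show "B \<in> sets (lebesgue_on S)"
    using assms by (metis null_setsD2 null_sets_restrict_space)
qed

text \<open>Preimages under \<open>f\<close> and \<open>g\<close> differ only inside a null set, and
  completeness makes such differences measurable. This gives access to the sections of
  \<open>a\<close>, which are known only through their agreement almost everywhere with sections of
  a Borel kernel.\<close>

lemma (in complete_measure) borel_measurable_AE_eq:
  assumes f: "f \<in> borel_measurable M" and eq: "AE x in M. f x = g x"
  shows "g \<in> borel_measurable M"
proof (rule measurableI)
  fix A :: "'b set" assume "A \<in> sets borel"
  then have "f -` A \<inter> space M \<in> sets M" using f by (rule measurable_sets[rotated])
  moreover have "AE x in M. x \<in> f -` A \<inter> space M \<longleftrightarrow> x \<in> g -` A \<inter> space M"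
    using eq by eventually_elim auto
  ultimately show "g -` A \<inter> space M \<in> sets M"
    using in_sets_AE by blast
qed auto

lemma (in complete_measure) integral_cong_AE_left:
  fixes f g :: "'a \<Rightarrow> 'b :: {banach, second_countable_topology}"
  assumes f: "f \<in> borel_measurable M" and eq: "AE x in M. f x = g x"
  shows "integral\<^sup>L M f = integral\<^sup>L M g"
  using borel_measurable_AE_eq[OF f eq] f eq by (intro integral_cong_AE)

text \<open>\<open>P\<close> carries no measurability, so the order of integration is exchanged for
  a measurable null set \<open>N\<close> that covers the failures of \<open>P\<close>.\<close>

lemma (in pair_sigma_finite) AE_pair_swap:
  assumes "AE p in M1 \<Otimes>\<^sub>M M2. P p"
  shows "AE y in M2. AE x in M1. P (x, y)"
proof -
  obtain N where N: "N \<in> null_sets (M1 \<Otimes>\<^sub>M M2)" "{p \<in> space (M1 \<Otimes>\<^sub>M M2). \<not> P p} \<subseteq> N"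
    using assms by (auto simp: eventually_ae_filter)
  have [measurable]: "N \<in> sets (M1 \<Otimes>\<^sub>M M2)" using N by auto
  have "AE p in M1 \<Otimes>\<^sub>M M2. p \<notin> N" using N(1) by (rule AE_not_in)
  then have "AE x in M1. AE y in M2. (x, y) \<notin> N" by (rule AE_pair)
  then have "AE y in M2. AE x in M1. (x, y) \<notin> N"
    by (subst (asm) AE_commute) auto
  then show ?thesis
  proof (rule AE_mp[OF _ AE_I2], intro impI)
    fix y assume "y \<in> space M2" "AE x in M1. (x, y) \<notin> N"
    from this(2) show "AE x in M1. P (x, y)"
      by (rule AE_mp[OF _ AE_I2]) (use N(2) \<open>y \<in> space M2\<close> in \<open>auto simp: space_pair_measure\<close>)
  qed
qed

text \<open>The bound is the nonnegativity of the variance of \<open>norm (f x)\<close>;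
  integrability comes from domination by \<open>1 + (norm (f x))\<^sup>2\<close>.\<close>

lemma (in prob_space) norm_integral_square_le:
  fixes f :: "'a \<Rightarrow> 'b :: {banach, second_countable_topology}"
  assumes f: "f \<in> borel_measurable M" and f2: "integrable M (\<lambda>x. (norm (f x))\<^sup>2)"
  shows "integrable M f" and "(norm (LINT x|M. f x))\<^sup>2 \<le> (LINT x|M. (norm (f x))\<^sup>2)"
proof -
  have "t \<le> 1 + t\<^sup>2" for t :: real
  proof -
    have "0 \<le> (t - 1/2)\<^sup>2 + 3/4" by simp
    then show ?thesis by (simp add: power2_eq_square algebra_simps)
  qed
  then have "norm (f x) \<le> norm (1 + (norm (f x))\<^sup>2)" for x
    using order_trans[OF _ abs_ge_self] unfolding real_norm_def by blast
  moreover have "integrable M (\<lambda>x. 1 + (norm (f x))\<^sup>2)" using f2 by simp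
  ultimately show int: "integrable M f"
    using f Bochner_Integration.integrable_bound by blast
  define c where "c = (LINT x|M. norm (f x))"
  have "0 \<le> (LINT x|M. (norm (f x) - c)\<^sup>2)" by simp
  also have "\<dots> = (LINT x|M. (norm (f x))\<^sup>2 - 2 * c * norm (f x) + c\<^sup>2)"
    by (simp add: power2_diff algebra_simps)
  also have "\<dots> = (LINT x|M. (norm (f x))\<^sup>2) - c\<^sup>2"
    using int f2 by (simp add: c_def prob_space power2_eq_square)
  finally have "c\<^sup>2 \<le> (LINT x|M. (norm (f x))\<^sup>2)" by simp
  moreover have "norm (LINT x|M. f x) \<le> c" unfolding c_def by simp
  ultimately show "(norm (LINT x|M. f x))\<^sup>2 \<le> (LINT x|M. (norm (f x))\<^sup>2)"
    by (meson norm_ge_zero order_trans power_mono)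
qed

section \<open>Lebesgue density\<close>

definition density_points :: "'a::euclidean_space set \<Rightarrow> 'a set"
  where "density_points S = {x. \<forall>e>0. \<forall>\<^sub>F r in at_right 0.
     measure lebesgue (ball x r - S) \<le> e * measure lebesgue (ball x r)}"

text \<open>The disjoint balls \<open>B\<close> with \<open>|B - S| > e |B|\<close> of a Vitali cover inside an open set that is barely
  larger than \<open>S\<close> have small total measure.\<close>

lemma negligible_low_density:
  fixes S :: "'a::euclidean_space set"
  assumes S: "S \<in> sets lebesgue" and "e > 0"
  shows "negligible {x \<in> S. \<forall>d>0. \<exists>r. 0 < r \<and> r < d \<and>
    e * measure lebesgue (ball x r) < measure lebesgue (ball x r - S)}" (is "negligible ?T")
proof (subst negligible_outer_le, intro allI impI)
  fix \<epsilon> :: real assume "\<epsilon> > 0"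
  \<comment> \<open>The excess is \<open>e * \<epsilon>\<close> because the disjoint balls chosen
    below have total measure at most \<open>1 / e\<close> times that of
    \<open>V - S\<close>.\<close>
  obtain V where V: "open V" "S \<subseteq> V" "V - S \<in> lmeasurable" "emeasure lebesgue (V - S) < ennreal (e * \<epsilon>)"
    using sets_lebesgue_outer_open[OF S, of "e * \<epsilon>"] \<open>e > 0\<close> \<open>\<epsilon> > 0\<close> by auto
  have mV: "measure lebesgue (V - S) \<le> e * \<epsilon>"
    using V(3,4) \<open>e > 0\<close> \<open>\<epsilon> > 0\<close>
    by (metis emeasure_eq_measure2 ennreal_less_iff less_eq_real_def measure_nonneg)
  define K where "K = {(x::'a, r). 0 < r \<and> ball x r \<subseteq> V \<and>
    e * measure lebesgue (ball x r) < measure lebesgue (ball x r - S)}"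
  have cover: "\<exists>i. i \<in> K \<and> x \<in> ball (fst i) (snd i) \<and> snd i < d" if x: "x \<in> ?T" and d: "0 < d" for x d
  proof -
    obtain d' where d': "d' > 0" "ball x d' \<subseteq> V"
      using V(1,2) x by (metis (no_types, lifting) mem_Collect_eq open_contains_ball subsetD)
    then obtain r where "0 < r" "r < min d d'"
      "e * measure lebesgue (ball x r) < measure lebesgue (ball x r - S)"
      using x d d'(1) by (smt (verit, ccfv_threshold) mem_Collect_eq min_less_iff_conj)
    moreover from this have "ball x r \<subseteq> V"
      using d'(2) subset_ball[of r d' x] by auto
    ultimately show ?thesis by (intro exI[of _ "(x, r)"]) (auto simp: K_def)
  qed
  obtain C where C: "countable C" "C \<subseteq> K"
    "pairwise (\<lambda>i j. disjnt (ball (fst i) (snd i)) (ball (fst j) (snd j))) C"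
    "negligible (?T - (\<Union>i\<in>C. ball (fst i) (snd i)))"
    using Vitali_covering_theorem_balls[of ?T K fst snd, OF cover] by blast
  let ?B = "\<lambda>i::'a \<times> real. ball (fst i) (snd i)"
  have bound: "measure lebesgue (\<Union>i\<in>F. ?B i) \<le> \<epsilon>" if F: "F \<subseteq> C" "finite F" for F
  proof -
    have "disjoint_family_on ?B F"
      using C(3) F(1) unfolding disjoint_family_on_def pairwise_def disjnt_def by blast
    then have dj: "disjoint_family_on (\<lambda>i. ?B i - S) F"
      unfolding disjoint_family_on_def by blast
    have BS: "?B i - S \<in> lmeasurable" for i
      using S by (intro fmeasurable_Diff) auto
    have "e * measure lebesgue (\<Union>i\<in>F. ?B i) \<le> e * (\<Sum>i\<in>F. measure lebesgue (?B i))"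
      using \<open>e > 0\<close> F by (intro mult_left_mono measure_UNION_le) auto
    also have "\<dots> \<le> (\<Sum>i\<in>F. measure lebesgue (?B i - S))"
      unfolding sum_distrib_left using F C(2) by (intro sum_mono) (force simp: K_def)
    also have "\<dots> = measure lebesgue (\<Union>i\<in>F. ?B i - S)"
      by (rule measure_finite_Union[symmetric])
        (use F dj BS[THEN fmeasurableD] BS[THEN fmeasurableD2] in \<open>unfold infinity_ennreal_def, blast+\<close>)
    also have "\<dots> \<le> measure lebesgue (V - S)"
      using F C(2) BS V(3)
      by (intro measure_mono_fmeasurable sets.finite_UN) (force simp: K_def)+
    also have "\<dots> \<le> e * \<epsilon>" by (rule mV)
    finally show ?thesis using \<open>e > 0\<close> by simp
  qed
  have UN: "(\<Union>i\<in>C. ?B i) \<in> lmeasurable" "measure lebesgue (\<Union>i\<in>C. ?B i) \<le> \<epsilon>"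
    using fmeasurable_UN_bound[OF C(1), of ?B lebesgue \<epsilon>] measure_UN_bound[OF C(1), of ?B lebesgue \<epsilon>] bound
    by auto
  let ?N = "?T - (\<Union>i\<in>C. ?B i)"
  have "measure lebesgue (?N \<union> (\<Union>i\<in>C. ?B i)) \<le> \<epsilon>"
    using UN C(4) measure_Un_le[of ?N lebesgue "\<Union>i\<in>C. ?B i"]
    by (auto simp: negligible_imp_measure0 negligible_imp_sets)
  moreover have "?N \<union> (\<Union>i\<in>C. ?B i) \<in> lmeasurable"
    by (rule fmeasurable.Un[OF negligible_imp_measurable[OF C(4)] UN(1)])
  ultimately show "\<exists>U. ?T \<subseteq> U \<and> U \<in> lmeasurable \<and> measure lebesgue U \<le> \<epsilon>"
    by (intro exI[of _ "?N \<union> (\<Union>i\<in>C. ?B i)"] conjI) auto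
qed

text \<open>A point of \<open>S\<close> that is no density point violates the condition for some
  \<open>e\<close>, hence for some smaller \<open>1 / Suc n\<close>, so countably many negligible
  low-density sets cover all exceptions.\<close>

theorem Lebesgue_density:
  fixes S :: "'a::euclidean_space set"
  assumes "S \<in> sets lebesgue"
  shows "negligible (S - density_points S)"
proof -
  let ?T = "\<lambda>e. {x \<in> S. \<forall>d>0. \<exists>r. 0 < r \<and> r < d \<and>
    e * measure lebesgue (ball x r) < measure lebesgue (ball x r - S)}"
  have "S - density_points S \<subseteq> (\<Union>n. ?T (1 / Suc n))"
  proof
    fix x assume x: "x \<in> S - density_points S"
    then obtain e where e: "e > 0" "\<not> (\<forall>\<^sub>F r in at_right 0.
        measure lebesgue (ball x r - S) \<le> e * measure lebesgue (ball x r))"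
      by (auto simp: density_points_def)
    obtain n where n: "1 / Suc n < e" using e(1) nat_approx_posE by blast
    have "\<exists>r. 0 < r \<and> r < d \<and> 1 / Suc n * measure lebesgue (ball x r) < measure lebesgue (ball x r - S)"
      if d: "d > 0" for d
    proof -
      obtain r where r: "0 < r" "r < d" "e * measure lebesgue (ball x r) < measure lebesgue (ball x r - S)"
        using e(2) d unfolding eventually_at_right_field by (meson not_le)
      then have "1 / Suc n * measure lebesgue (ball x r) < measure lebesgue (ball x r - S)"
        using n by (smt (verit, best) measure_nonneg mult_right_mono)
      with r show ?thesis by blast
    qed
    with x show "x \<in> (\<Union>n. ?T (1 / Suc n))" by blast
  qed
  moreover have "negligible (?T (1 / Suc n))" for n
    by (rule negligible_low_density[OF assms]) simp
  then have "negligible (\<Union>n. ?T (1 / Suc n))"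
    by (intro negligible_countable_Union) blast+
  ultimately show ?thesis using negligible_subset by blast
qed

section \<open>Lebesgue points on the unit interval\<close>

lemma prob_space_lebI: "prob_space lebI"
  by (rule prob_spaceI) (simp add: emeasure_restrict_space space_restrict_space)

interpretation lebI: prob_space lebI by (rule prob_space_lebI)

interpretation lebI: complete_measure lebI by (rule complete_measure_lebesgue_on) simp

interpretation lebI2: pair_prob_space lebI lebI ..

lemma space_lebI [simp]: "space lebI = {0..1}"
  by (simp add: space_restrict_space)

lemma AE_lebI_iff: "(AE i in lebI. P i) \<longleftrightarrow> {i \<in> {0..1}. \<not> P i} \<in> null_sets lebesgue"
  by (subst lebI.AE_iff_null_sets) (auto simp: null_sets_restrict_space)

lemma sets_lebI_iff: "S \<in> sets lebI \<longleftrightarrow> S \<subseteq> {0..1} \<and> S \<in> sets lebesgue"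
  by (subst sets_restrict_space_iff) auto

text \<open>Replaces the varying domain in the definition of Lebesgue points by an indicator weight
  on the fixed probability space \<open>lebI\<close>.\<close>

lemma integral_lebesgue_on_Int:
  fixes f :: "real \<Rightarrow> 'b :: {banach, second_countable_topology}"
  assumes "B \<in> sets lebesgue"
  shows "(LINT y|lebesgue_on ({0..1} \<inter> B). f y) = (LINT y|lebI. indicator B y *\<^sub>R f y)"
proof -
  have "(LINT y|lebesgue_on ({0..1} \<inter> B). f y)
      = (LINT y|lebesgue. indicator {0..1} y *\<^sub>R (indicator B y *\<^sub>R f y))"
    using assms by (subst integral_restrict_space) (auto simp: indicator_inter_arith)
  also have "\<dots> = (LINT y|lebI. indicator B y *\<^sub>R f y)"
    by (subst integral_restrict_space) auto
  finally show ?thesis .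
qed

lemma integral_lebI_indicator:
  assumes "B \<in> sets lebesgue"
  shows "(LINT y|lebI. indicator B y) = measure lebesgue ({0..1} \<inter> B)"
proof -
  have "(LINT y|lebI. indicator B y :: real) = (LINT y|lebesgue. indicator {0..1} y *\<^sub>R indicator B y)"
    by (rule integral_restrict_space) simp
  also have "\<dots> = (LINT y|lebesgue. indicator ({0..1} \<inter> B) y)"
    by (simp only: indicator_inter_arith real_scaleR_def)
  also have "\<dots> = measure lebesgue ({0..1} \<inter> B)"
    using assms by simp
  finally show ?thesis .
qed

lemma integrable_lebI_bounded:
  fixes f :: "real \<Rightarrow> 'b :: {banach, second_countable_topology}"
  assumes "f \<in> borel_measurable lebI" "\<And>y. norm (f y) \<le> B"
  shows "integrable lebI f"
  using assms by (intro lebI.integrable_const_bound[where B = B]) auto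

lemma indicator_borel_measurable_lebI [measurable]:
  assumes "B \<in> sets lebesgue"
  shows "(indicator B :: real \<Rightarrow> real) \<in> borel_measurable lebI"
  using assms by (intro measurable_restrict_space1) simp

lemma integrable_lebI_indicator:
  fixes f :: "real \<Rightarrow> real"
  assumes f: "integrable lebI f" and [measurable]: "B \<in> sets lebesgue"
  shows "integrable lebI (\<lambda>y. indicator B y * f y)"
proof (rule Bochner_Integration.integrable_bound[OF f])
  show "(\<lambda>y. indicator B y * f y) \<in> borel_measurable lebI"
    using f by measurable
  show "AE y in lebI. norm (indicator B y * f y) \<le> norm (f y)"
    by (rule AE_I2) (simp add: indicator_def)
qed

lemma integrable_lebI_indicator':
  "B \<in> sets lebesgue \<Longrightarrow> integrable lebI (\<lambda>y. indicator B y :: real)"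
  using integrable_lebI_indicator[of "\<lambda>_. 1" B] by simp

lemma density_pointsD:
  "x \<in> density_points S \<Longrightarrow> e > 0 \<Longrightarrow>
    \<forall>\<^sub>F r in at_right 0. measure lebesgue (ball x r - S) \<le> e * measure lebesgue (ball x r)"
  by (simp add: density_points_def)

lemma borel_measurable_lebI: "f \<in> borel_measurable borel \<Longrightarrow> f \<in> borel_measurable lebI"
  by (intro measurable_restrict_space1 measurable_completion) simp

text \<open>Radii \<open>1/(n + 1)\<close> suffice to detect Lebesgue points, and with a sequence of radii the condition is
  jointly measurable in the section and the point, so that the two can be interchanged by Fubini.\<close>

definition osc :: "(real \<Rightarrow> real) \<Rightarrow> real \<Rightarrow> nat \<Rightarrow> real"
  where "osc f j n =
    real (Suc n) * (LINT y|lebI. indicator (ball j (1 / real (Suc n))) y * \<bar>f y - f j\<bar>)"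

lemma osc_nonneg: "0 \<le> osc f j n"
  by (simp add: osc_def)

text \<open>Lebesgue differentiation is deduced from the density theorem. Off a null set,
  \<open>j\<close> is a density point of every strip \<open>q < f < q'\<close> with rational bounds
  that contains it, and a thin strip around \<open>f j\<close> fills nearly all of a small
  ball.\<close>

lemma AE_osc_tendsto_0:
  fixes f :: "real \<Rightarrow> real"
  assumes f [measurable]: "f \<in> borel_measurable lebI" and range: "\<And>y. f y \<in> {0..1}"
  shows "AE j in lebI. osc f j \<longlonglongrightarrow> 0"
proof -
  define S where "S q q' = {y \<in> {0..1}. q < f y \<and> f y < q'}" for q q'
  have "{y \<in> space lebI. q < f y \<and> f y < q'} \<in> sets lebI" for q q'
    by measurable
  then have S: "S q q' \<in> sets lebesgue" for q q'
    by (simp add: S_def sets_lebI_iff)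
  define N where "N = (\<Union>q\<in>\<rat>. \<Union>q'\<in>\<rat>. S q q' - density_points (S q q'))"
  have "N \<in> null_sets lebesgue"
    unfolding N_def using S
    by (intro null_sets_UN' countable_rat) (auto simp: negligible_iff_null_sets[symmetric] intro!: Lebesgue_density)
  moreover have "osc f j \<longlonglongrightarrow> 0" if j: "j \<in> {0..1}" "j \<notin> N" for j
  proof (rule LIMSEQ_I)
    fix e :: real assume "e > 0"
    obtain q where q: "q \<in> \<rat>" "f j - e / 10 < q" "q < f j"
      using Rats_dense_in_real[of "f j - e / 10" "f j"] \<open>e > 0\<close> by auto
    obtain q' where q': "q' \<in> \<rat>" "f j < q'" "q' < f j + e / 10"
      using Rats_dense_in_real[of "f j" "f j + e / 10"] \<open>e > 0\<close> by auto
    have "j \<in> S q q'" using j q q' by (auto simp: S_def)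
    then have "j \<in> density_points (S q q')" using j q q' by (auto simp: N_def)
    then have "\<forall>\<^sub>F r in at_right 0.
        measure lebesgue (ball j r - S q q') \<le> e / 10 * measure lebesgue (ball j r)"
      using \<open>e > 0\<close> by (intro density_pointsD) auto
    then obtain d where d: "d > 0" "\<And>r. 0 < r \<Longrightarrow> r < d \<Longrightarrow>
        measure lebesgue (ball j r - S q q') \<le> e / 10 * measure lebesgue (ball j r)"
      unfolding eventually_at_right_field by auto
    obtain n0 where n0: "1 / Suc n0 < d" using d(1) nat_approx_posE by blast
    have "norm (osc f j n - 0) < e" if "n \<ge> n0" for n
    proof -
      define r where "r = 1 / real (Suc n)"
      have r: "0 < r" "r < d" "real (Suc n) * r = 1"
        using that by (auto simp: r_def intro!: le_less_trans[OF _ n0] frac_le)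
      have mb: "measure lebesgue (ball j r) = 2 * r"
        using r(1) by (simp add: ball_eq_greaterThanLessThan)
      have [measurable]: "ball j r \<in> sets lebesgue" "S q q' \<in> sets lebesgue" using S by auto
      \<comment> \<open>Inside the strip \<open>f\<close> stays close to \<open>f j\<close>;
        outside, the difference is at most \<open>1\<close> because \<open>f\<close> takes values in
        \<open>{0..1}\<close>, and density makes that part of the ball small.\<close>
      have le: "indicator (ball j r) y * \<bar>f y - f j\<bar>
          \<le> e / 5 * indicator (ball j r) y + indicator (ball j r - S q q') y" if "y \<in> {0..1}" for y
        using range[of y] range[of j] q q' that \<open>e > 0\<close> by (auto simp: indicator_def S_def abs_if)
      have "(LINT y|lebI. indicator (ball j r) y * \<bar>f y - f j\<bar>)
          \<le> (LINT y|lebI. e / 5 * indicator (ball j r) y + indicator (ball j r - S q q') y)"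
      proof (rule integral_mono_AE)
        have "integrable lebI f"
          using range by (intro integrable_lebI_bounded[where B = 1]) auto
        then show "integrable lebI (\<lambda>y. indicator (ball j r) y * \<bar>f y - f j\<bar>)"
          by (intro integrable_lebI_indicator) auto
        show "integrable lebI (\<lambda>y. e / 5 * indicator (ball j r) y + indicator (ball j r - S q q') y)"
          using S by (intro Bochner_Integration.integrable_add integrable_mult_right
              integrable_lebI_indicator') auto
      qed (use le in auto)
      also have "\<dots> = e / 5 * (LINT y|lebI. indicator (ball j r) y)
          + (LINT y|lebI. indicator (ball j r - S q q') y)"
        using S by (subst Bochner_Integration.integral_add)
          (auto intro!: integrable_mult_right integrable_lebI_indicator' simp del: indicator_simps)
      also have "\<dots> = e / 5 * measure lebesgue ({0..1} \<inter> ball j r)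
          + measure lebesgue ({0..1} \<inter> (ball j r - S q q'))"
        by (simp only: integral_lebI_indicator[OF \<open>ball j r \<in> sets lebesgue\<close>]
            integral_lebI_indicator[OF sets.Diff[OF \<open>ball j r \<in> sets lebesgue\<close> \<open>S q q' \<in> sets lebesgue\<close>]])
      also have "\<dots> \<le> e / 5 * measure lebesgue (ball j r) + measure lebesgue (ball j r - S q q')"
        using \<open>e > 0\<close> S by (intro add_mono mult_left_mono measure_mono_fmeasurable fmeasurable_Diff) auto
      also have "\<dots> \<le> e / 5 * (2 * r) + e / 10 * (2 * r)"
        using d(2)[OF r(1,2)] unfolding mb by simp
      also have "\<dots> = 3 / 5 * e * r" by simp
      finally have "osc f j n \<le> real (Suc n) * (3 / 5 * e * r)"
        unfolding osc_def r_def[symmetric] by (intro mult_left_mono) auto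
      also have "\<dots> = 3 / 5 * e" using r(3) by (simp add: mult.assoc mult.left_commute)
      finally show ?thesis using osc_nonneg[of f j n] \<open>e > 0\<close> by simp
    qed
    then show "\<exists>n0. \<forall>n\<ge>n0. norm (osc f j n - 0) < e" by blast
  qed
  ultimately show ?thesis
    unfolding AE_lebI_iff by (elim null_sets_completion_subset[rotated]) auto
qed

text \<open>For radii up to \<open>1 / 2\<close> at least one half of the ball lies in
  \<open>{0..1}\<close>, even at an endpoint. Averages over the clipped ball are thus comparable
  with division by \<open>r\<close>.\<close>

lemma measure_Icc_Int_cball:
  fixes j r :: real
  assumes "j \<in> {0..1}" "0 < r" "r \<le> 1 / 2"
  shows "r \<le> measure lebesgue ({0..1} \<inter> cball j r)" "measure lebesgue ({0..1} \<inter> cball j r) \<le> 2 * r"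
proof -
  have eq: "{0..1} \<inter> cball j r = {max 0 (j - r)..min 1 (j + r)}"
    by (auto simp: cball_eq_atLeastAtMost)
  show "r \<le> measure lebesgue ({0..1} \<inter> cball j r)" "measure lebesgue ({0..1} \<inter> cball j r) \<le> 2 * r"
    using assms unfolding eq by (auto simp: max_def min_def)
qed

lemma lebesgue_point_alt:
  "lebesgue_point f j \<longleftrightarrow> j \<in> {0..1} \<and> integrable lebI f \<and>
    ((\<lambda>r. (LINT y|lebI. indicator (cball j r) y * \<bar>f y - f j\<bar>)
            / measure lebesgue ({0..1} \<inter> cball j r)) \<longlongrightarrow> 0) (at_right 0)"
  unfolding lebesgue_point_def by (simp add: integral_lebesgue_on_Int)

text \<open>A radius \<open>r\<close> is compared with the next larger radius
  \<open>1 / Suc n\<close> of the sequence. Consecutive radii differ by a factor of at most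
  \<open>2\<close>, so the averages over the intermediate balls are at most
  \<open>2 * osc f j n\<close>.\<close>

lemma lebesgue_point_if_osc:
  assumes j: "j \<in> {0..1}" and f: "integrable lebI f" and osc: "osc f j \<longlonglongrightarrow> 0"
  shows "lebesgue_point f j"
  unfolding lebesgue_point_alt
proof (intro conjI j f tendstoI)
  fix e :: real assume "e > 0"
  obtain N where N: "\<And>n. n \<ge> N \<Longrightarrow> osc f j n < e / 2"
    using order_tendstoD(2)[OF osc, of "e / 2"] \<open>e > 0\<close> unfolding eventually_sequentially by auto
  have "dist ((LINT y|lebI. indicator (cball j r) y * \<bar>f y - f j\<bar>) / measure lebesgue ({0..1} \<inter> cball j r)) 0 < e"
    if r: "0 < r" "r < 1 / real (N + 2)" for r
  proof -
    \<comment> \<open>With this choice \<open>Suc n < 1 / r \<le> n + 2\<close>. The truncation by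
      \<open>nat\<close> is harmless, since \<open>r < 1 / (N + 2)\<close> keeps the argument at
      least \<open>N\<close>.\<close>
    define n where "n = nat (\<lceil>1 / r\<rceil> - 2)"
    have "1 / r > real (N + 2)"
      using r by (simp add: field_simps)
    then have "\<lceil>1 / r\<rceil> - 2 \<ge> int N" by linarith
    then have n: "n \<ge> N" "real n = of_int \<lceil>1 / r\<rceil> - 2" by (auto simp: n_def)
    then have "real (Suc n) < 1 / r" "1 / r \<le> real (n + 2)" by linarith+
    then have rn: "real (Suc n) * r < 1" "1 \<le> real (n + 2) * r"
      using r(1) by (simp_all only: pos_less_divide_eq pos_divide_le_eq)
    then have rn': "r < 1 / real (Suc n)"
      by (subst pos_less_divide_eq) (simp_all only: mult.commute of_nat_0_less_iff zero_less_Suc)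
    have "1 / real (N + 2) \<le> 1 / 2" by (simp add: field_simps)
    then have "r \<le> 1 / 2" using r(2) by linarith
    note m = measure_Icc_Int_cball(1)[OF j r(1) this]
    let ?J = "LINT y|lebI. indicator (ball j (1 / real (Suc n))) y * \<bar>f y - f j\<bar>"
    have int: "integrable lebI (\<lambda>y. indicator B y * \<bar>f y - f j\<bar>)" if "B \<in> sets lebesgue" for B
      using f that by (intro integrable_lebI_indicator) auto
    have "(LINT y|lebI. indicator (cball j r) y * \<bar>f y - f j\<bar>) \<le> ?J"
      using rn' by (intro integral_mono[OF int int]) (auto simp: indicator_def)
    then have "(LINT y|lebI. indicator (cball j r) y * \<bar>f y - f j\<bar>) / measure lebesgue ({0..1} \<inter> cball j r) \<le> ?J / r"
      using m r(1) by (intro frac_le) auto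
    also have "\<dots> \<le> real (n + 2) * ?J"
    proof -
      have "?J \<le> real (n + 2) * r * ?J" using rn(2) mult_right_mono[of 1 "real (n + 2) * r" ?J] by simp
      then show ?thesis using r(1) by (simp add: field_simps)
    qed
    also have "\<dots> \<le> 2 * real (Suc n) * ?J"
      by (intro mult_right_mono) auto
    also have "\<dots> = 2 * osc f j n" by (simp add: osc_def)
    also have "\<dots> < e" using N[OF n(1)] by simp
    finally have "(LINT y|lebI. indicator (cball j r) y * \<bar>f y - f j\<bar>)
        / measure lebesgue ({0..1} \<inter> cball j r) < e" .
    moreover have "0 \<le> (LINT y|lebI. indicator (cball j r) y * \<bar>f y - f j\<bar>)
        / measure lebesgue ({0..1} \<inter> cball j r)"
      by (intro divide_nonneg_nonneg integral_nonneg_AE measure_nonneg AE_I2) simp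
    ultimately show ?thesis by (simp only: dist_real_def diff_0_right abs_of_nonneg)
  qed
  then show "\<forall>\<^sub>F r in at_right 0. dist ((LINT y|lebI. indicator (cball j r) y * \<bar>f y - f j\<bar>)
      / measure lebesgue ({0..1} \<inter> cball j r)) 0 < e"
    unfolding eventually_at_right_field by (intro exI[of _ "1 / real (N + 2)"]) auto
qed

text \<open>The averages ignore null sets, but they compare \<open>f\<close> with its actual value
  at \<open>j\<close>; hence the separate pointwise hypothesis there.\<close>

lemma lebesgue_point_cong_AE:
  assumes f [measurable]: "f \<in> borel_measurable lebI" and eq: "AE y in lebI. f y = g y" and "f j = g j"
  shows "lebesgue_point f j \<longleftrightarrow> lebesgue_point g j"
proof -
  have [measurable]: "g \<in> borel_measurable lebI" by (rule lebI.borel_measurable_AE_eq[OF f eq])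
  have "integrable lebI f \<longleftrightarrow> integrable lebI g"
    using eq by (intro integrable_cong_AE) auto
  moreover have [measurable]: "cball j r \<in> sets lebesgue" for r by auto
  have "(LINT y|lebI. indicator (cball j r) y * \<bar>f y - f j\<bar>)
      = (LINT y|lebI. indicator (cball j r) y * \<bar>g y - g j\<bar>)" for r
    using eq \<open>f j = g j\<close> by (intro integral_cong_AE) auto
  ultimately show ?thesis by (simp add: lebesgue_point_alt)
qed

text \<open>For small \<open>r\<close> at least half of the ball around \<open>j\<close> belongs to
  \<open>S\<close>, and almost everywhere on that part the deviation from \<open>f j\<close> equals
  \<open>\<bar>f j\<bar>\<close>. The averages therefore cannot fall below
  \<open>\<bar>f j\<bar> / 2\<close>.\<close>

lemma lebesgue_point_eq_0:
  assumes f: "lebesgue_point f j" and S: "S \<in> sets lebI" and j: "j \<in> density_points S"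
    and zero: "AE y in lebI. y \<in> S \<longrightarrow> f y = 0"
  shows "f j = 0"
proof (rule ccontr)
  assume "f j \<noteq> 0"
  have jI: "j \<in> {0..1}" and int: "integrable lebI f" and lim:
    "((\<lambda>r. (LINT y|lebI. indicator (cball j r) y * \<bar>f y - f j\<bar>)
            / measure lebesgue ({0..1} \<inter> cball j r)) \<longlongrightarrow> 0) (at_right 0)"
    using f by (auto simp: lebesgue_point_alt)
  have [measurable]: "S \<in> sets lebesgue" and SI: "S \<subseteq> {0..1}" using S by (auto simp: sets_lebI_iff)
  have "S \<in> lmeasurable"
    by (rule bounded_set_imp_lmeasurable[OF bounded_subset[OF bounded_closed_interval SI] \<open>S \<in> sets lebesgue\<close>])
  have "\<forall>\<^sub>F r in at_right 0. (LINT y|lebI. indicator (cball j r) y * \<bar>f y - f j\<bar>)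
            / measure lebesgue ({0..1} \<inter> cball j r) < \<bar>f j\<bar> / 2"
    using \<open>f j \<noteq> 0\<close> by (intro order_tendstoD(2)[OF lim]) simp
  moreover have "\<forall>\<^sub>F r in at_right 0. measure lebesgue (ball j r - S) \<le> 1 / 2 * measure lebesgue (ball j r)"
    using j by (intro density_pointsD) auto
  moreover have "\<forall>\<^sub>F r in at_right 0. 0 < r \<and> r \<le> (1 / 2 :: real)"
    unfolding eventually_at_right_field by (intro exI[of _ "1 / 2"]) auto
  \<comment> \<open>The three conditions exclude each other at every single \<open>r\<close>, while
    the filter \<open>at_right 0\<close> is nontrivial.\<close>
  ultimately have "\<forall>\<^sub>F r in at_right (0::real). False"
  proof eventually_elim
    case (elim r)
    have [measurable]: "cball j r \<in> sets lebesgue" "ball j r \<in> sets lebesgue" by auto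
    have mb: "measure lebesgue (ball j r) = 2 * r"
      using elim(3) by (simp add: ball_eq_greaterThanLessThan)
    have "measure lebesgue (ball j r) \<le> measure lebesgue (ball j r - S) + measure lebesgue (S \<inter> cball j r)"
    proof -
      have "measure lebesgue (ball j r) \<le> measure lebesgue ((ball j r - S) \<union> (S \<inter> cball j r))"
        by (intro measure_mono_fmeasurable fmeasurable.Un fmeasurable_Diff fmeasurable_Int_fmeasurable \<open>S \<in> lmeasurable\<close>) auto
      also have "\<dots> \<le> measure lebesgue (ball j r - S) + measure lebesgue (S \<inter> cball j r)"
        by (intro measure_Un_le) auto
      finally show ?thesis .
    qed
    then have r: "r \<le> measure lebesgue (S \<inter> cball j r)"
      using elim(2) unfolding mb by simp
    have "measure lebesgue (S \<inter> cball j r) = (LINT y|lebI. indicator (S \<inter> cball j r) y)"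
      using SI by (subst integral_lebI_indicator) (auto intro!: arg_cong[of _ _ "measure lebesgue"])
    then have "\<bar>f j\<bar> * r \<le> \<bar>f j\<bar> * (LINT y|lebI. indicator (S \<inter> cball j r) y)"
      using r by (intro mult_left_mono) auto
    also have "\<dots> = (LINT y|lebI. \<bar>f j\<bar> * indicator (S \<inter> cball j r) y)" by simp
    also have "\<dots> \<le> (LINT y|lebI. indicator (cball j r) y * \<bar>f y - f j\<bar>)"
    proof (rule integral_mono_AE)
      show "integrable lebI (\<lambda>y. \<bar>f j\<bar> * indicator (S \<inter> cball j r) y)"
        by (subst mult.commute, intro integrable_lebI_indicator) auto
      show "integrable lebI (\<lambda>y. indicator (cball j r) y * \<bar>f y - f j\<bar>)"
        using int by (intro integrable_lebI_indicator) auto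
      show "AE y in lebI. \<bar>f j\<bar> * indicator (S \<inter> cball j r) y \<le> indicator (cball j r) y * \<bar>f y - f j\<bar>"
        using zero by eventually_elim (auto simp: indicator_def)
    qed
    finally have "\<bar>f j\<bar> * r \<le> (LINT y|lebI. indicator (cball j r) y * \<bar>f y - f j\<bar>)" .
    moreover have "r \<le> measure lebesgue ({0..1} \<inter> cball j r)" "measure lebesgue ({0..1} \<inter> cball j r) \<le> 2 * r"
      using measure_Icc_Int_cball[OF jI] elim(3) by auto
    ultimately have "\<bar>f j\<bar> / 2 \<le> (LINT y|lebI. indicator (cball j r) y * \<bar>f y - f j\<bar>)
        / measure lebesgue ({0..1} \<inter> cball j r)"
      using elim(3) by (subst pos_le_divide_eq) (auto intro: order_trans[OF mult_left_mono])
    then show ?case using elim(1) by simp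
  qed
  then show False by simp
qed

section \<open>Kernels and their energy\<close>

abbreviation lebII :: "(real \<times> real) measure"
  where "lebII \<equiv> lebI \<Otimes>\<^sub>M lebI"

definition vertex_degree :: "(real \<times> real \<Rightarrow> real) \<Rightarrow> real \<Rightarrow> real"
  where "vertex_degree a i = (LINT j|lebI. a (i, j))"

text \<open>For graphons this is known as connectedness. The iterated quantifier suits the chain
  arguments, which handle one section at a time.\<close>

definition irreducible_kernel :: "(real \<times> real \<Rightarrow> real) \<Rightarrow> bool"
  where "irreducible_kernel a \<longleftrightarrow>
    (\<forall>S \<in> sets lebI. (AE i in lebI. AE j in lebI. i \<in> S \<longrightarrow> j \<notin> S \<longrightarrow> a (i, j) = 0) \<longrightarrow>
      (AE i in lebI. i \<in> S) \<or> (AE i in lebI. i \<notin> S))"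

text \<open>The Dirichlet form of the kernel with every unordered pair counted twice, whence the
  factor \<open>1 / 2\<close> in \<open>inner_graph_laplacian\<close>.\<close>

definition energy :: "(real \<times> real \<Rightarrow> real) \<Rightarrow> (real \<Rightarrow> 'b::real_normed_vector) \<Rightarrow> real"
  where "energy a x = (LINT p|lebII. a p * (norm (x (fst p) - x (snd p)))\<^sup>2)"

text \<open>\<open>lebII\<close> is a product of completed measures and not the Lebesgue measure on
  the square. Borel functions are measurable for it and have Borel sections, which is the reason for
  working with a Borel version of \<open>a\<close>.\<close>

lemma borel_measurable_lebII:
  fixes f :: "real \<times> real \<Rightarrow> 'b :: topological_space"
  assumes f: "f \<in> borel_measurable borel"
  shows "f \<in> borel_measurable lebII"
proof -
  have [measurable]: "(\<lambda>x. x) \<in> lebI \<rightarrow>\<^sub>M borel"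
    by (intro measurable_restrict_space1 measurable_completion) simp
  have "(\<lambda>p. (fst p, snd p)) \<in> lebI \<Otimes>\<^sub>M lebI \<rightarrow>\<^sub>M borel \<Otimes>\<^sub>M borel"
    by measurable
  then show ?thesis
    using f measurable_compose[of "\<lambda>p. (fst p, snd p)" lebII "borel \<Otimes>\<^sub>M borel" f borel]
    by (simp add: borel_prod)
qed

lemma space_lebII [simp]: "space lebII = {0..1} \<times> {0..1}"
  by (simp add: space_pair_measure)

lemma integrable_lebI_pair:
  fixes f :: "real \<Rightarrow> 'b :: {banach, second_countable_topology}"
  assumes f: "integrable lebI f"
  shows "integrable lebII (\<lambda>p. f (fst p))" "integrable lebII (\<lambda>p. f (snd p))"
    and "(LINT p|lebII. f (fst p)) = (LINT i|lebI. f i)"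
    and "(LINT p|lebII. f (snd p)) = (LINT i|lebI. f i)"
proof -
  have fst: "distr lebII lebI fst = lebI" by (rule lebI.distr_pair_fst)
  have m: "f \<in> borel_measurable lebI" using f by simp
  show 1: "integrable lebII (\<lambda>p. f (fst p))"
    using f integrable_distr_eq[of fst "lebII" lebI f] m unfolding fst by simp
  show 2: "(LINT p|lebII. f (fst p)) = (LINT i|lebI. f i)"
    using integral_distr[of fst "lebII" lebI f] m unfolding fst by simp
  show "integrable lebII (\<lambda>p. f (snd p))"
    using lebI2.integrable_product_swap[OF 1] by (simp add: case_prod_beta')
  show "(LINT p|lebII. f (snd p)) = (LINT i|lebI. f i)"
    using lebI2.integral_product_swap[of "\<lambda>p. f (fst p)"] m 2 by (simp add: case_prod_beta')
qed

lemma norm_diff_square_le: "(norm (u - v))\<^sup>2 \<le> 2 * (norm u)\<^sup>2 + 2 * (norm v)\<^sup>2"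
  for u v :: "'b::real_normed_vector"
proof -
  have "(norm (u - v))\<^sup>2 \<le> (norm u + norm v)\<^sup>2"
    by (intro power_mono norm_triangle_ineq4) simp
  also have "\<dots> \<le> 2 * (norm u)\<^sup>2 + 2 * (norm v)\<^sup>2"
    using sum_squares_bound[of "norm u" "norm v"] by (simp add: power2_sum)
  finally show ?thesis .
qed

lemma L2I_measurable: "x \<in> L2I \<Longrightarrow> x \<in> borel_measurable lebI"
  and L2I_square_integrable: "x \<in> L2I \<Longrightarrow> integrable lebI (\<lambda>i. (norm (x i))\<^sup>2)"
  by (simp_all add: L2I_def)

lemma L2I_diff: "x \<in> L2I \<Longrightarrow> y \<in> L2I \<Longrightarrow> (\<lambda>i. x i - y i) \<in> L2I"
  unfolding L2I_def mem_Collect_eq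
proof (intro conjI; elim conjE)
  assume x: "x \<in> borel_measurable lebI" "integrable lebI (\<lambda>i. (norm (x i))\<^sup>2)"
    and y: "y \<in> borel_measurable lebI" "integrable lebI (\<lambda>i. (norm (y i))\<^sup>2)"
  show m: "(\<lambda>i. x i - y i) \<in> borel_measurable lebI" using x y by simp
  have "integrable lebI (\<lambda>i. 2 * (norm (x i))\<^sup>2 + 2 * (norm (y i))\<^sup>2)" using x y by simp
  then show "integrable lebI (\<lambda>i. (norm (x i - y i))\<^sup>2)"
    by (rule Bochner_Integration.integrable_bound)
      (use m norm_diff_square_le in \<open>auto intro!: AE_I2 simp: abs_of_nonneg\<close>)
qed

lemma normL2_square: "(normL2 x)\<^sup>2 = (LINT i|lebI. (norm (x i))\<^sup>2)"
  by (simp add: normL2_def)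

lemma L2I_AE_zero_iff:
  assumes "x \<in> L2I"
  shows "(AE i in lebI. x i = 0) \<longleftrightarrow> (LINT i|lebI. (norm (x i))\<^sup>2) = 0"
  using integral_nonneg_eq_0_iff_AE[OF L2I_square_integrable[OF assms]] by simp

text \<open>The properties hold at every point instead of almost everywhere, so that no section of
  \<open>w\<close> is exceptional.\<close>

locale kernel =
  fixes w :: "real \<times> real \<Rightarrow> real"
  assumes borel: "w \<in> borel_measurable borel"
    and range: "w p \<in> {0..1}"
    and sym: "w (i, j) = w (j, i)"
begin

lemma nonneg: "0 \<le> w p" and le_1: "w p \<le> 1"
  using range[of p] by auto

lemma measurable_pair [measurable]: "w \<in> borel_measurable lebII"
  by (rule borel_measurable_lebII[OF borel])

lemma section_borel: "(\<lambda>j. w (i, j)) \<in> borel_measurable borel"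
  using borel by measurable

lemma measurable_section [measurable]: "(\<lambda>j. w (i, j)) \<in> borel_measurable lebI"
  by (intro measurable_restrict_space1 measurable_completion) (simp add: section_borel)

lemma integrable_section: "integrable lebI (\<lambda>j. w (i, j))"
  using nonneg le_1 by (intro integrable_lebI_bounded[where B = 1]) (auto simp: abs_of_nonneg)

lemma integrable_w: "integrable lebII w"
  using nonneg le_1 by (intro lebI2.integrable_const_bound[where B = 1]) (auto simp: abs_of_nonneg)

lemma integrable_w_mult:
  fixes f :: "real \<times> real \<Rightarrow> 'b :: {banach, second_countable_topology}"
  assumes f: "integrable lebII f"
  shows "integrable lebII (\<lambda>p. w p *\<^sub>R f p)"
  using f by (rule Bochner_Integration.integrable_bound)
    (use f in \<open>auto intro!: AE_I2 mult_left_le_one_le simp: nonneg le_1\<close>)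

lemma integrable_section_mult:
  fixes f :: "real \<Rightarrow> 'b :: {banach, second_countable_topology}"
  assumes f: "integrable lebI f"
  shows "integrable lebI (\<lambda>j. w (i, j) *\<^sub>R f j)"
  using f by (rule Bochner_Integration.integrable_bound)
    (use f in \<open>auto intro!: AE_I2 mult_left_le_one_le simp: nonneg le_1\<close>)

lemma degree_measurable [measurable]: "vertex_degree w \<in> borel_measurable lebI"
proof -
  have "(\<lambda>i. LINT j|lebI. w (i, j)) \<in> borel_measurable lebI"
    by measurable
  then show ?thesis by (simp add: vertex_degree_def[abs_def])
qed

lemma degree_nonneg: "0 \<le> vertex_degree w i"
  unfolding vertex_degree_def by (intro integral_nonneg_AE AE_I2 nonneg)

lemma degree_le_1: "vertex_degree w i \<le> 1"
proof -
  have "vertex_degree w i \<le> (LINT j|lebI. 1)"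
    unfolding vertex_degree_def by (intro integral_mono integrable_section) (auto simp: le_1)
  then show ?thesis using lebI.prob_space by simp
qed

lemma integrable_energy:
  assumes "x \<in> L2I"
  shows "integrable lebII (\<lambda>p. w p * (norm (x (fst p) - x (snd p)))\<^sup>2)"
proof -
  have [measurable]: "x \<in> borel_measurable lebI" by (rule L2I_measurable[OF assms])
  have "integrable lebII (\<lambda>p. 2 * (norm (x (fst p)))\<^sup>2 + 2 * (norm (x (snd p)))\<^sup>2)"
    using integrable_lebI_pair[OF L2I_square_integrable[OF assms]] by auto
  then have "integrable lebII (\<lambda>p. (norm (x (fst p) - x (snd p)))\<^sup>2)"
    by (rule Bochner_Integration.integrable_bound)
      (use norm_diff_square_le in \<open>auto intro!: AE_I2 simp: abs_of_nonneg\<close>)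
  from integrable_w_mult[OF this] show ?thesis by simp
qed

lemma energy_nonneg: "0 \<le> energy w x"
  unfolding energy_def by (intro integral_nonneg_AE AE_I2) (simp add: nonneg)

lemma measurable_graph_laplacian [measurable]:
  assumes [measurable]: "x \<in> borel_measurable lebI"
  shows "graph_laplacian w x \<in> borel_measurable lebI"
proof -
  have "(\<lambda>i. LINT j|lebI. w (i, j) *\<^sub>R (x i - x j)) \<in> borel_measurable lebI"
    by measurable
  then show ?thesis by (simp add: graph_laplacian_def[abs_def])
qed

text \<open>The integrand is averaged with its transpose: by symmetry of \<open>w\<close> the sum of
  \<open>(u - v) \<bullet> u\<close> and \<open>(v - u) \<bullet> v\<close> is the squared distance.
  The inequality \<open>le\<close> supplies the integrability that Fubini requires.\<close>

lemma inner_graph_laplacian: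
  assumes x: "x \<in> L2I"
  shows "innerL2 (graph_laplacian w x) x = energy w x / 2"
proof -
  have [measurable]: "x \<in> borel_measurable lebI" by (rule L2I_measurable[OF x])
  define F where "F p = w p * ((x (fst p) - x (snd p)) \<bullet> x (fst p))" for p
  have [measurable]: "F \<in> borel_measurable lebII" unfolding F_def by measurable
  have le: "\<bar>(u - v) \<bullet> u\<bar> \<le> 2 * (norm u)\<^sup>2 + (norm v)\<^sup>2" for u v :: "real ^ 'd"
  proof -
    have "\<bar>(u - v) \<bullet> u\<bar> \<le> norm (u - v) * norm u" by (rule Cauchy_Schwarz_ineq2)
    also have "\<dots> \<le> (norm u + norm v) * norm u"
      by (intro mult_right_mono norm_triangle_ineq4) simp
    also have "\<dots> \<le> 2 * (norm u)\<^sup>2 + (norm v)\<^sup>2"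
      using sum_squares_bound[of "norm u" "norm v"] mult.commute[of "norm u" "norm v"]
        zero_le_power2[of "norm u"] zero_le_power2[of "norm v"]
      unfolding power2_eq_square distrib_right by linarith
    finally show ?thesis .
  qed
  have "integrable lebII (\<lambda>p. 2 * (norm (x (fst p)))\<^sup>2 + (norm (x (snd p)))\<^sup>2)"
    using integrable_lebI_pair[OF L2I_square_integrable[OF x]] by auto
  then have "integrable lebII (\<lambda>p. (x (fst p) - x (snd p)) \<bullet> x (fst p))"
    by (rule Bochner_Integration.integrable_bound)
      (use le in \<open>auto intro!: AE_I2 simp: abs_of_nonneg\<close>)
  from integrable_w_mult[OF this] have F: "integrable lebII F"
    by (simp add: F_def[abs_def])
  have "innerL2 (graph_laplacian w x) x = (LINT i|lebI. LINT j|lebI. F (i, j))"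
    unfolding innerL2_def
  proof (intro Bochner_Integration.integral_cong refl)
    fix i
    have "integrable lebI (\<lambda>j. w (i, j) *\<^sub>R (x i - x j))"
      using L2I_integrable[OF x] by (intro integrable_section_mult) auto
    then show "graph_laplacian w x i \<bullet> x i = (LINT j|lebI. F (i, j))"
      by (simp add: graph_laplacian_def F_def flip: integral_inner_left)
  qed
  also have F_int: "\<dots> = (LINT p|lebII. F p)"
    by (rule lebI2.integral_fst'[OF F])
  finally have 1: "innerL2 (graph_laplacian w x) x = (LINT p|lebII. F p)" .
  also have "\<dots> = (LINT p|lebII. F (snd p, fst p))"
    using lebI2.integral_product_swap[of F] by (simp add: case_prod_beta')
  finally have 2: "innerL2 (graph_laplacian w x) x = (LINT p|lebII. F (snd p, fst p))" .
  have F': "integrable lebII (\<lambda>p. F (snd p, fst p))"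
    using lebI2.integrable_product_swap[OF F] by (simp add: case_prod_beta')
  have "2 * innerL2 (graph_laplacian w x) x = (LINT p|lebII. F p + F (snd p, fst p))"
    using 1 2 F F' by simp
  also have "\<dots> = energy w x"
    unfolding energy_def
  proof (intro Bochner_Integration.integral_cong refl)
    fix p :: "real \<times> real"
    have "w (snd p, fst p) = w p" using sym[of "snd p" "fst p"] by simp
    then show "F p + F (snd p, fst p) = w p * (norm (x (fst p) - x (snd p)))\<^sup>2"
      by (simp add: F_def power2_norm_eq_inner inner_diff_left inner_diff_right inner_commute algebra_simps)
  qed
  finally show ?thesis by simp
qed

text \<open>Cauchy-Schwarz in \<open>j\<close> moves the square inside the integral, and the square
  of \<open>w\<close> is at most \<open>w\<close>. Hence small energy forces a small Laplacian in
  the mean square sense.\<close>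

lemma graph_laplacian_square_le:
  assumes x: "x \<in> L2I"
  shows "integrable lebI (\<lambda>i. (norm (graph_laplacian w x i))\<^sup>2)"
    and "(LINT i|lebI. (norm (graph_laplacian w x i))\<^sup>2) \<le> energy w x"
proof -
  have [measurable]: "x \<in> borel_measurable lebI" by (rule L2I_measurable[OF x])
  let ?G = "\<lambda>i. LINT j|lebI. w (i, j) * (norm (x i - x j))\<^sup>2"
  have G: "integrable lebI ?G" "(LINT i|lebI. ?G i) = energy w x"
    using lebI2.integrable_fst'[OF integrable_energy[OF x]] lebI2.integral_fst'[OF integrable_energy[OF x]]
    by (simp_all add: energy_def)
  have le: "(norm (graph_laplacian w x i))\<^sup>2 \<le> ?G i" for i
  proof -
    have "(\<lambda>j. x i - x j) \<in> L2I"
      by (rule L2I_diff) (use x in \<open>simp_all add: L2I_def\<close>)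
    note int = integrable_section_mult[OF L2I_square_integrable[OF this], of i, simplified]
    have sq_le: "(norm (w (i, j) *\<^sub>R (x i - x j)))\<^sup>2 \<le> w (i, j) * (norm (x i - x j))\<^sup>2" for j
      using nonneg[of "(i, j)"] le_1[of "(i, j)"] mult_left_le_one_le[of "w (i, j)" "w (i, j)"]
      by (simp add: power_mult_distrib power2_eq_square[of "w (i, j)"] mult_right_mono)
    have int2: "integrable lebI (\<lambda>j. (norm (w (i, j) *\<^sub>R (x i - x j)))\<^sup>2)"
      using int by (rule Bochner_Integration.integrable_bound)
        (use sq_le in \<open>auto intro!: AE_I2 simp: abs_of_nonneg nonneg\<close>)
    have "(norm (graph_laplacian w x i))\<^sup>2 \<le> (LINT j|lebI. (norm (w (i, j) *\<^sub>R (x i - x j)))\<^sup>2)"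
      unfolding graph_laplacian_def by (rule lebI.norm_integral_square_le(2)[OF _ int2]) measurable
    also have "\<dots> \<le> ?G i" by (intro integral_mono int2 int sq_le)
    finally show ?thesis .
  qed
  show "integrable lebI (\<lambda>i. (norm (graph_laplacian w x i))\<^sup>2)"
    using G(1) by (rule Bochner_Integration.integrable_bound)
      (use le in \<open>auto intro!: AE_I2 order_trans[OF le abs_ge_self]\<close>)
  then show "(LINT i|lebI. (norm (graph_laplacian w x i))\<^sup>2) \<le> energy w x"
    unfolding G(2)[symmetric] using G(1) le by (intro integral_mono)
qed

text \<open>A form of continuity of the energy in L2, used to pass to a strong limit. The constant
  \<open>8\<close> results from applying \<open>norm_diff_square_le\<close> twice and adding the
  contributions of both variables.\<close>

lemma energy_le:
  assumes x: "x \<in> L2I" and y: "y \<in> L2I"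
  shows "energy w x \<le> 2 * energy w y + 8 * (LINT i|lebI. (norm (x i - y i))\<^sup>2)"
proof -
  let ?d = "\<lambda>i. (norm (x i - y i))\<^sup>2"
  note d = integrable_lebI_pair[OF L2I_square_integrable[OF L2I_diff[OF x y]]]
  note E = integrable_energy[OF y]
  have "energy w x \<le> (LINT p|lebII. 2 * (w p * (norm (y (fst p) - y (snd p)))\<^sup>2) +
      (4 * ?d (fst p) + 4 * ?d (snd p)))"
    unfolding energy_def
  proof (intro integral_mono integrable_energy[OF x])
    show "integrable lebII (\<lambda>p. 2 * (w p * (norm (y (fst p) - y (snd p)))\<^sup>2) +
      (4 * ?d (fst p) + 4 * ?d (snd p)))"
      using d(1,2) E by simp
    fix p :: "real \<times> real"
    let ?i = "fst p" and ?j = "snd p"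
    have "(norm (x ?i - x ?j))\<^sup>2 = (norm ((y ?i - y ?j) - ((y ?i - x ?i) - (y ?j - x ?j))))\<^sup>2" by simp
    also have "\<dots> \<le> 2 * (norm (y ?i - y ?j))\<^sup>2 + 2 * (norm ((y ?i - x ?i) - (y ?j - x ?j)))\<^sup>2"
      by (rule norm_diff_square_le)
    also have "\<dots> \<le> 2 * (norm (y ?i - y ?j))\<^sup>2 + 2 * (2 * ?d ?i + 2 * ?d ?j)"
      using norm_diff_square_le[of "y ?i - x ?i" "y ?j - x ?j"] by (simp add: norm_minus_commute)
    finally have "w p * (norm (x ?i - x ?j))\<^sup>2
        \<le> w p * (2 * (norm (y ?i - y ?j))\<^sup>2 + (4 * ?d ?i + 4 * ?d ?j))"
      by (intro mult_left_mono nonneg) simp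
    also have "\<dots> \<le> 2 * (w p * (norm (y ?i - y ?j))\<^sup>2) + (4 * ?d ?i + 4 * ?d ?j)"
      using mult_left_le_one_le[of "4 * ?d ?i + 4 * ?d ?j" "w p"] nonneg le_1
      by (simp add: distrib_left)
    finally show "w p * (norm (x ?i - x ?j))\<^sup>2
        \<le> 2 * (w p * (norm (y ?i - y ?j))\<^sup>2) + (4 * ?d ?i + 4 * ?d ?j)" .
  qed
  also have "\<dots> = 2 * energy w y + 8 * (LINT i|lebI. ?d i)"
    unfolding energy_def using d E by simp
  finally show ?thesis .
qed

lemma lambda2_le:
  fixes x :: "real \<Rightarrow> real ^ 'd"
  assumes x: "x \<in> const_perp" and nz: "\<not> (AE i in lebI. x i = 0)"
  shows "lambda2 (graph_laplacian w :: (real \<Rightarrow> real ^ 'd) \<Rightarrow> _) * (LINT i|lebI. (norm (x i))\<^sup>2) \<le> energy w x / 2"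
proof -
  let ?X = "{x :: real \<Rightarrow> real ^ 'd. x \<in> const_perp \<and> \<not> (AE i in lebI. x i = 0)}"
  have L2: "x \<in> L2I" if "x \<in> ?X" for x :: "real \<Rightarrow> real ^ 'd"
    using that by (simp add: const_perp_def)
  have "lambda2 (graph_laplacian w :: (real \<Rightarrow> real ^ 'd) \<Rightarrow> _) \<le> innerL2 (graph_laplacian w x) x / (normL2 x)\<^sup>2"
    unfolding lambda2_def
  proof (rule cINF_lower)
    \<comment> \<open>A real infimum is a lower bound only for a set bounded below; nonnegativity of
      the energy provides the bound \<open>0\<close>.\<close>
    show "bdd_below ((\<lambda>x. innerL2 (graph_laplacian w x) x / (normL2 x)\<^sup>2) ` ?X)"
      using L2 by (intro bdd_belowI2[where m = 0]) (auto simp: inner_graph_laplacian energy_nonneg)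
  qed (use x nz in simp)
  moreover have "(LINT i|lebI. (norm (x i))\<^sup>2) > 0"
    using L2I_AE_zero_iff[OF L2[of x]] x nz by (simp add: order_less_le)
  ultimately show ?thesis
    using inner_graph_laplacian[OF L2[of x]] x nz by (simp add: normL2_square pos_le_divide_eq)
qed

end

section \<open>Cuts\<close>

lemma lebI_indicator:
  assumes "S \<in> sets lebI"
  shows "integrable lebI (indicator S :: real \<Rightarrow> real)" "(LINT i|lebI. indicator S i) = measure lebI S"
  using assms sets.sets_into_space[OF assms] by (simp_all add: lebI.emeasure_eq_measure Int_absorb2)

context kernel
begin

text \<open>The centred indicator of \<open>S\<close> points along one arbitrary axis, the index
  being \<open>undefined\<close>. Its squared norm is a Bernoulli variance, and its energy is the
  weight of the cut counted in both directions.\<close>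

lemma cut_test_function:
  fixes S :: "real set"
  assumes S: "S \<in> sets lebI"
  defines "x \<equiv> \<lambda>i. (indicator S i - measure lebI S) *\<^sub>R axis (undefined :: 'd :: finite) (1::real)"
  shows "x \<in> const_perp"
    and "(LINT i|lebI. (norm (x i))\<^sup>2) = measure lebI S * (1 - measure lebI S)"
    and "energy w x = (LINT p|lebII. w p * (indicator S (fst p) - indicator S (snd p))\<^sup>2)"
proof -
  let ?\<mu> = "measure lebI S" and ?e = "axis (undefined :: 'd) (1::real)"
  have [simp]: "S \<inter> {0..1} = S" using S by (auto simp: sets_lebI_iff)
  have [simp]: "integrable lebI (indicator S :: real \<Rightarrow> real)" "(LINT i|lebI. indicator S i) = ?\<mu>"
    using lebI_indicator[OF S] by simp_all
  have "(norm (x i))\<^sup>2 = (indicator S i - ?\<mu>)\<^sup>2" for i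
    by (simp add: x_def norm_axis_1)
  then have sq: "(norm (x i))\<^sup>2 = (1 - 2 * ?\<mu>) * indicator S i + ?\<mu>\<^sup>2" for i
    by (simp add: indicator_def power2_eq_square algebra_simps)
  have "x \<in> borel_measurable lebI" unfolding x_def using S by measurable
  then have L2: "x \<in> L2I" unfolding L2I_def mem_Collect_eq sq by simp
  have "(LINT i|lebI. x i) = (LINT i|lebI. indicator S i - ?\<mu>) *\<^sub>R ?e"
    unfolding x_def by (rule integral_scaleR_left) simp
  also have "\<dots> = 0" using lebI.prob_space by simp
  finally show "x \<in> const_perp" using L2 by (simp add: const_perp_eq)
  show "(LINT i|lebI. (norm (x i))\<^sup>2) = ?\<mu> * (1 - ?\<mu>)"
    unfolding sq using lebI.prob_space by (simp add: power2_eq_square algebra_simps)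
  have "x i - x j = (indicator S i - indicator S j) *\<^sub>R ?e" for i j
    by (simp add: x_def scaleR_diff_left)
  then show "energy w x = (LINT p|lebII. w p * (indicator S (fst p) - indicator S (snd p))\<^sup>2)"
    unfolding energy_def by (simp add: norm_axis_1)
qed

text \<open>The easy direction of a Cheeger inequality: the Rayleigh quotient of the centred
  indicator, with denominators cleared.\<close>

lemma lambda2_cut:
  assumes S: "S \<in> sets lebI"
  shows "lambda2 (graph_laplacian w :: (real \<Rightarrow> real ^ 'd) \<Rightarrow> _) * (measure lebI S * (1 - measure lebI S))
    \<le> (LINT p|lebII. w p * (indicator S (fst p) - indicator S (snd p))\<^sup>2) / 2"
proof -
  let ?x = "\<lambda>i. (indicator S i - measure lebI S) *\<^sub>R axis (undefined :: 'd) (1::real)"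
  note x = cut_test_function[OF S, where 'd = 'd]
  have L2: "?x \<in> L2I" using x(1) by (simp add: const_perp_def)
  show ?thesis
  proof (cases "AE i in lebI. ?x i = 0")
    \<comment> \<open>A null or conull \<open>S\<close> gives a test function that is zero in L2 and
      hence no competitor in the infimum, but then the left-hand side vanishes.\<close>
    case True
    then have zero: "measure lebI S * (1 - measure lebI S) = 0"
      using x(2) L2I_AE_zero_iff[OF L2] by simp
    show ?thesis unfolding zero using x(3) energy_nonneg[of ?x] by simp
  next
    case False
    then show ?thesis using lambda2_le[OF x(1)] x(2,3) by simp
  qed
qed

text \<open>If no weight crosses the cut, \<open>lambda2_cut\<close> leaves only measures
  \<open>0\<close> and \<open>1\<close> for \<open>S\<close>. Symmetry of \<open>w\<close> supplies
  the reverse crossing direction.\<close>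

lemma irreducible_kernel_if_lambda2_pos:
  assumes pos: "lambda2 (graph_laplacian w :: (real \<Rightarrow> real ^ 'd) \<Rightarrow> _) > 0"
  shows "irreducible_kernel w"
  unfolding irreducible_kernel_def
proof (intro ballI impI)
  fix S assume S [measurable]: "S \<in> sets lebI"
    and zero: "AE i in lebI. AE j in lebI. i \<in> S \<longrightarrow> j \<notin> S \<longrightarrow> w (i, j) = 0"
  let ?P = "\<lambda>i j. i \<in> S \<longrightarrow> j \<notin> S \<longrightarrow> w (i, j) = 0"
  have P: "{p \<in> space lebII. ?P (fst p) (snd p)} \<in> sets lebII" by measurable
  have P': "{p \<in> space lebII. ?P (snd p) (fst p)} \<in> sets lebII" by measurable
  have 1: "AE p in lebII. ?P (fst p) (snd p)"
    using zero by (subst lebI2.AE_pair_iff[OF P, symmetric])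
  have "AE i in lebI. AE j in lebI. ?P j i"
    using zero by (subst lebI2.AE_commute[OF P, symmetric])
  then have 2: "AE p in lebII. ?P (snd p) (fst p)"
    by (subst lebI2.AE_pair_iff[OF P', symmetric])
  have "AE p in lebII. w p * (indicator S (fst p) - indicator S (snd p))\<^sup>2 = 0"
    using 1 2
  proof eventually_elim
    case (elim p)
    then show ?case using sym[of "fst p" "snd p"] by (auto simp: indicator_def)
  qed
  then have "(LINT p|lebII. w p * (indicator S (fst p) - indicator S (snd p))\<^sup>2) = 0"
    by (rule integral_eq_zero_AE)
  then have "measure lebI S * (1 - measure lebI S) \<le> 0"
    using lambda2_cut[OF S, where 'd = 'd] pos by (simp add: mult_le_0_iff)
  then have "measure lebI S = 0 \<or> measure lebI S = 1"
    using lebI.prob_le_1[of S] measure_nonneg[of lebI S] by (auto simp: mult_le_0_iff)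
  then show "(AE i in lebI. i \<in> S) \<or> (AE i in lebI. i \<notin> S)"
    using lebI.prob_eq_0[OF S] lebI.AE_in_set_eq_1[OF S] by auto
qed

text \<open>A pair that crosses the cut has an endpoint in \<open>S\<close>; each of the two choices
  of that endpoint contributes the total degree of \<open>S\<close>.\<close>

lemma cut_le_degree:
  assumes [measurable]: "S \<in> sets lebI"
  shows "(LINT p|lebII. w p * (indicator S (fst p) - indicator S (snd p))\<^sup>2)
    \<le> 2 * (LINT i|lebI. indicator S i * vertex_degree w i)"
proof -
  let ?F = "\<lambda>p. w p * indicator S (fst p) :: real"
  have [simp]: "integrable lebI (indicator S :: real \<Rightarrow> real)"
    using lebI_indicator[OF assms] by simp
  have F: "integrable lebII ?F" and F': "integrable lebII (\<lambda>p. w p * indicator S (snd p) :: real)"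
    using integrable_lebI_pair[of "indicator S :: real \<Rightarrow> real"] integrable_w_mult[of "\<lambda>p. indicator S (fst p) :: real"]
      integrable_w_mult[of "\<lambda>p. indicator S (snd p) :: real"] by simp_all
  have "(LINT p|lebII. ?F p) = (LINT i|lebI. indicator S i * vertex_degree w i)"
    using lebI2.integral_fst'[OF F] by (simp add: vertex_degree_def mult.commute)
  moreover have "(LINT p|lebII. w p * indicator S (snd p)) = (LINT p|lebII. ?F p)"
    using lebI2.integral_product_swap[of ?F] by (simp add: case_prod_beta' sym[of "snd _"])
  moreover have "(LINT p|lebII. w p * (indicator S (fst p) - indicator S (snd p))\<^sup>2)
      \<le> (LINT p|lebII. ?F p + w p * indicator S (snd p))"
  proof (rule integral_mono)
    show "integrable lebII (\<lambda>p. w p * (indicator S (fst p) - indicator S (snd p))\<^sup>2 :: real)"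
      by (rule Bochner_Integration.integrable_bound[OF integrable_w])
        (auto intro!: AE_I2 simp: indicator_def nonneg)
    show "integrable lebII (\<lambda>p. ?F p + w p * indicator S (snd p))"
      using F F' by simp
  qed (auto simp: indicator_def nonneg)
  ultimately show ?thesis using F F' by simp
qed

text \<open>Let \<open>S\<close> be the points of degree below \<open>l / 4\<close> in a set of
  measure at most \<open>1 / 2\<close>. If \<open>S\<close> had positive measure, its cut would give
  \<open>l / 2 \<le> l / 4\<close>. The interval is split into halves to keep the complement of
  \<open>S\<close> at measure at least \<open>1 / 2\<close>.\<close>

lemma degree_bound_if_lambda2_pos:
  assumes pos: "lambda2 (graph_laplacian w :: (real \<Rightarrow> real ^ 'd) \<Rightarrow> _) > 0"
  shows "\<exists>\<delta>>0. AE i in lebI. \<delta> \<le> vertex_degree w i"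
proof (intro exI conjI)
  define l where "l = lambda2 (graph_laplacian w :: (real \<Rightarrow> real ^ 'd) \<Rightarrow> _)"
  show "0 < l / 4" using pos by (simp add: l_def)
  have half: "AE i in lebI. i \<in> H \<longrightarrow> l / 4 \<le> vertex_degree w i"
    if H [measurable]: "H \<in> sets lebI" and H2: "measure lebI H \<le> 1 / 2" for H
  proof (rule ccontr)
    assume neg: "\<not> (AE i in lebI. i \<in> H \<longrightarrow> l / 4 \<le> vertex_degree w i)"
    define S where "S = {i \<in> space lebI. i \<in> H \<and> vertex_degree w i < l / 4}"
    have S [measurable]: "S \<in> sets lebI" unfolding S_def by measurable
    have "measure lebI S \<noteq> 0"
    proof
      assume "measure lebI S = 0"
      then have "AE i in lebI. i \<notin> S" using lebI.prob_eq_0[OF S] by simp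
      then have "AE i in lebI. i \<in> H \<longrightarrow> l / 4 \<le> vertex_degree w i"
        by (rule AE_mp[OF _ AE_I2]) (auto simp: S_def)
      then show False using neg by simp
    qed
    then have S0: "measure lebI S > 0" by (simp add: zero_less_measure_iff)
    have "measure lebI S \<le> measure lebI H"
      using H by (intro lebI.finite_measure_mono) (auto simp: S_def)
    then have S2: "measure lebI S \<le> 1 / 2" using H2 by simp
    have "l * (measure lebI S * (1 - measure lebI S)) \<le> (LINT i|lebI. indicator S i * vertex_degree w i)"
      using lambda2_cut[OF S, where 'd = 'd] cut_le_degree[OF S] unfolding l_def by simp
    also have "\<dots> \<le> (LINT i|lebI. l / 4 * indicator S i)"
    proof (rule integral_mono)
      have "integrable lebI (vertex_degree w)"
        using degree_nonneg degree_le_1 by (intro integrable_lebI_bounded[where B = 1]) (auto simp: abs_of_nonneg)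
      then show "integrable lebI (\<lambda>i. indicator S i * vertex_degree w i)"
        using S by (intro integrable_lebI_indicator) (auto simp: sets_lebI_iff)
      show "integrable lebI (\<lambda>i. l / 4 * indicator S i)"
        using lebI_indicator[OF S] by simp
    qed (auto simp: indicator_def S_def)
    also have "\<dots> = l / 4 * measure lebI S" using lebI_indicator[OF S] by simp
    finally have "(l * (1 - measure lebI S)) * measure lebI S \<le> l / 4 * measure lebI S" by (simp add: mult_ac)
    then have "l * (1 - measure lebI S) \<le> l / 4" using S0 by (rule mult_right_le_imp_le)
    moreover have "l * (1 / 2) \<le> l * (1 - measure lebI S)"
      using S2 pos by (intro mult_left_mono) (auto simp: l_def)
    ultimately show False using pos by (simp add: l_def)
  qed
  have "measure lebI {0..1/2} = 1/2" "measure lebI {1/2..1} = 1/2"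
    by (simp_all add: measure_restrict_space)
  then have "AE i in lebI. i \<in> {0..1/2} \<longrightarrow> l / 4 \<le> vertex_degree w i"
    "AE i in lebI. i \<in> {1/2..1} \<longrightarrow> l / 4 \<le> vertex_degree w i"
    by (intro half; simp add: sets_lebI_iff)+
  then show "AE i in lebI. l / 4 \<le> vertex_degree w i"
    by (rule AE_mp[OF _ AE_mp[OF _ AE_I2]]) auto
qed

text \<open>No weight leaves the set where a coordinate of \<open>x\<close> is positive, because
  \<open>x\<close> agrees at the two ends of almost every edge. So the coordinate has one weak sign
  almost everywhere, and mean zero makes it vanish.\<close>

lemma AE_zero_if_energy_zero:
  fixes x :: "real \<Rightarrow> real ^ 'd"
  assumes irr: "irreducible_kernel w" and x: "x \<in> L2I" and E: "energy w x = 0"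
    and mean: "(LINT i|lebI. x i) = 0"
  shows "AE i in lebI. x i = 0"
proof -
  have [measurable]: "x \<in> borel_measurable lebI" by (rule L2I_measurable[OF x])
  have "AE p in lebII. w p * (norm (x (fst p) - x (snd p)))\<^sup>2 = 0"
    using E integral_nonneg_eq_0_iff_AE[OF integrable_energy[OF x]] nonneg by (simp add: energy_def)
  from lebI2.AE_pair[OF this]
  have eq: "AE i in lebI. AE j in lebI. w (i, j) = 0 \<or> x i = x j" by simp
  have "AE i in lebI. x i $ k = 0" for k
  proof -
    define S where "S = {i \<in> space lebI. x i $ k > 0}"
    have "S \<in> sets lebI" unfolding S_def by measurable
    moreover have "AE i in lebI. AE j in lebI. i \<in> S \<longrightarrow> j \<notin> S \<longrightarrow> w (i, j) = 0"
      using eq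
    proof eventually_elim
      case (elim i)
      then show ?case by (rule AE_mp[OF _ AE_I2]) (auto simp: S_def)
    qed
    ultimately have cases: "(AE i in lebI. i \<in> S) \<or> (AE i in lebI. i \<notin> S)"
      using irr unfolding irreducible_kernel_def by blast
    have int: "integrable lebI (\<lambda>i. x i $ k)" and zero: "(LINT i|lebI. x i $ k) = 0"
      using integrable_bounded_linear[OF bounded_linear_vec_nth L2I_integrable[OF x], of k]
        integral_bounded_linear[OF bounded_linear_vec_nth L2I_integrable[OF x], of k] mean by simp_all
    from cases show ?thesis
    proof
      assume "AE i in lebI. i \<in> S"
      then have "AE i in lebI. 0 \<le> x i $ k" by eventually_elim (simp add: S_def)
      then show ?thesis using integral_nonneg_eq_0_iff_AE[OF int] zero by simp
    next
      assume "AE i in lebI. i \<notin> S"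
      then have "AE i in lebI. 0 \<le> - x i $ k"
        by (rule AE_mp[OF _ AE_I2]) (simp add: S_def)
      then show ?thesis using integral_nonneg_eq_0_iff_AE[of lebI "\<lambda>i. - x i $ k"] int zero by simp
    qed
  qed
  then have "AE i in lebI. \<forall>k\<in>UNIV. x i $ k = 0" by (subst AE_finite_all) auto
  then show ?thesis by eventually_elim (simp add: vec_eq_iff)
qed

end

section \<open>Weak sequential compactness\<close>

lemma convergent_if_uniformly_close:
  fixes b :: "nat \<Rightarrow> 'b :: {real_normed_vector, complete_space}"
  assumes "\<And>e. e > 0 \<Longrightarrow> \<exists>c. convergent c \<and> (\<forall>n. norm (b n - c n) \<le> e)"
  shows "convergent b"
proof (rule Cauchy_convergent, rule CauchyI)
  fix e :: real assume "e > 0"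
  then obtain c where c: "convergent c" "\<And>n. norm (b n - c n) \<le> e / 4"
    using assms[of "e / 4"] by auto
  obtain N where N: "\<And>m n. m \<ge> N \<Longrightarrow> n \<ge> N \<Longrightarrow> norm (c m - c n) < e / 4"
    using convergent_Cauchy[OF c(1)] \<open>e > 0\<close> unfolding Cauchy_iff by (meson divide_pos_pos zero_less_numeral)
  have "norm (b m - b n) < e" if mn: "m \<ge> N" "n \<ge> N" for m n
  proof -
    have "norm (b m - b n) = norm ((b m - c m) + (c m - c n) - (b n - c n))" by simp
    also have "\<dots> \<le> norm (b m - c m) + norm (c m - c n) + norm (b n - c n)"
      by (meson norm_triangle_ineq norm_triangle_ineq4 add_right_mono order_trans)
    finally show ?thesis using N[OF mn] c(2)[of m] c(2)[of n] \<open>e > 0\<close> by simp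
  qed
  then show "\<exists>M. \<forall>m\<ge>M. \<forall>n\<ge>M. norm (b m - b n) < e" by blast
qed

text \<open>Cauchy-Schwarz in the form of a weighted arithmetic-geometric mean inequality: with
  weight \<open>e\<close> both halves of the majorant integrate to at most
  \<open>e / 2\<close>.\<close>

lemma norm_integral_scaleR_le:
  fixes y :: "real \<Rightarrow> real ^ 'd"
  assumes f [measurable]: "f \<in> borel_measurable lebI" and f2: "integrable lebI (\<lambda>j. (f j)\<^sup>2)"
    and y: "y \<in> L2I" and y1: "(LINT j|lebI. (norm (y j))\<^sup>2) \<le> 1"
    and e: "e > 0" "(LINT j|lebI. (f j)\<^sup>2) \<le> e\<^sup>2"
  shows "integrable lebI (\<lambda>j. f j *\<^sub>R y j)" "norm (LINT j|lebI. f j *\<^sub>R y j) \<le> e"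
proof -
  have [measurable]: "y \<in> borel_measurable lebI" by (rule L2I_measurable[OF y])
  have le: "norm (f j *\<^sub>R y j) \<le> ((f j)\<^sup>2 / e + e * (norm (y j))\<^sup>2) / 2" for j
  proof -
    have "2 * e * (\<bar>f j\<bar> * norm (y j)) \<le> (f j)\<^sup>2 + (e * norm (y j))\<^sup>2"
      using sum_squares_bound[of "\<bar>f j\<bar>" "e * norm (y j)"] by (simp add: mult_ac)
    also have "\<dots> = e * ((f j)\<^sup>2 / e + e * (norm (y j))\<^sup>2)"
      using e(1) by (simp add: power2_eq_square algebra_simps)
    finally have "e * (2 * (\<bar>f j\<bar> * norm (y j))) \<le> e * ((f j)\<^sup>2 / e + e * (norm (y j))\<^sup>2)"
      by (simp add: mult_ac)
    then show ?thesis using e(1) by simp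
  qed
  have int: "integrable lebI (\<lambda>j. ((f j)\<^sup>2 / e + e * (norm (y j))\<^sup>2) / 2)"
    using f2 L2I_square_integrable[OF y] by simp
  then show "integrable lebI (\<lambda>j. f j *\<^sub>R y j)"
    by (rule Bochner_Integration.integrable_bound)
      (measurable, unfold real_norm_def, intro AE_I2 order_trans[OF le abs_ge_self])
  have "norm (LINT j|lebI. f j *\<^sub>R y j) \<le> (LINT j|lebI. ((f j)\<^sup>2 / e + e * (norm (y j))\<^sup>2) / 2)"
    by (rule Bochner_Integration.integral_norm_bound_integral[OF _ int le]) fact
  also have "\<dots> = ((LINT j|lebI. (f j)\<^sup>2) / e + e * (LINT j|lebI. (norm (y j))\<^sup>2)) / 2"
    using f2 L2I_square_integrable[OF y] by simp
  also have "\<dots> \<le> (e\<^sup>2 / e + e * 1) / 2"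
    using e y1 by (intro divide_right_mono add_mono mult_left_mono) auto
  also have "\<dots> = e" using e by (simp add: power2_eq_square)
  finally show "norm (LINT j|lebI. f j *\<^sub>R y j) \<le> e" .
qed

locale unit_ball_sequence =
  fixes y :: "nat \<Rightarrow> real \<Rightarrow> real ^ 'd"
  assumes L2: "y n \<in> L2I" and norm_le_1: "(LINT j|lebI. (norm (y n j))\<^sup>2) \<le> 1"
begin

text \<open>The functions against which the sequence converges weakly. The class is enlarged below
  from a generator to Borel sets, simple functions and bounded Borel functions.\<close>

definition tested :: "(real \<Rightarrow> real) \<Rightarrow> bool"
  where "tested f \<longleftrightarrow> convergent (\<lambda>n. LINT j|lebI. f j *\<^sub>R y n j)"

lemma integrable_scaleR:
  assumes "f \<in> borel_measurable lebI" "\<And>j. \<bar>f j\<bar> \<le> B"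
  shows "integrable lebI (\<lambda>j. f j *\<^sub>R y n j)"
proof -
  have B: "B \<ge> 0" using assms(2)[of 0] by simp
  have sq: "(f j)\<^sup>2 \<le> B\<^sup>2" for j
    using assms(2)[of j] by (metis abs_ge_zero power2_abs power_mono)
  have "integrable lebI (\<lambda>j. (f j)\<^sup>2)"
    using assms(1) sq by (intro integrable_lebI_bounded[where B = "B\<^sup>2"]) auto
  moreover from this have "(LINT j|lebI. (f j)\<^sup>2) \<le> (LINT j|lebI. B\<^sup>2)"
    using sq by (intro integral_mono) auto
  then have "(LINT j|lebI. (f j)\<^sup>2) \<le> B\<^sup>2" using lebI.prob_space by simp
  \<comment> \<open>The Cauchy-Schwarz lemma wants a positive bound, while \<open>B\<close> may be
    \<open>0\<close>; hence \<open>B + 1\<close>.\<close>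
  then have "(LINT j|lebI. (f j)\<^sup>2) \<le> (B + 1)\<^sup>2"
    using B by (simp add: power2_sum)
  ultimately show ?thesis
    using assms(1) B by (intro norm_integral_scaleR_le(1)[OF _ _ L2 norm_le_1, of f "B + 1"]) auto
qed

text \<open>Dominated convergence gives \<open>s m\<close> close to \<open>f\<close> in L2. Since
  the sequence lies in the unit ball, the integrals are then close uniformly in \<open>n\<close>,
  and convergence is inherited.\<close>

lemma tested_limit:
  assumes f [measurable]: "f \<in> borel_measurable lebI" and s [measurable]: "\<And>m. s m \<in> borel_measurable lebI"
    and bound: "\<And>j. \<bar>f j\<bar> \<le> B" "\<And>m j. \<bar>s m j\<bar> \<le> B"
    and lim: "\<And>j. (\<lambda>m. s m j) \<longlonglongrightarrow> f j" and tested: "\<And>m. tested (s m)"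
  shows "tested f"
  unfolding tested_def
proof (rule convergent_if_uniformly_close)
  fix e :: real assume e: "e > 0"
  have B: "(f j - s m j)\<^sup>2 \<le> (2 * B)\<^sup>2" for m j
    using bound(1)[of j] bound(2)[of m j]
    by (intro power2_le_iff_abs_le[THEN iffD2]) auto
  have "(\<lambda>m. LINT j|lebI. (f j - s m j)\<^sup>2) \<longlonglongrightarrow> (LINT j|lebI. 0)"
  proof (rule integral_dominated_convergence)
    show "integrable lebI (\<lambda>_. (2 * B)\<^sup>2)" by simp
    have "(\<lambda>m. (f j - s m j)\<^sup>2) \<longlonglongrightarrow> (f j - f j)\<^sup>2" for j
      by (intro tendsto_intros lim)
    then show "AE j in lebI. (\<lambda>m. (f j - s m j)\<^sup>2) \<longlonglongrightarrow> 0" by simp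
  qed (use B in auto)
  then have "\<forall>\<^sub>F m in sequentially. (LINT j|lebI. (f j - s m j)\<^sup>2) < e\<^sup>2"
    using e by (intro order_tendstoD(2)) auto
  then obtain m where m: "(LINT j|lebI. (f j - s m j)\<^sup>2) < e\<^sup>2"
    unfolding eventually_sequentially by blast
  have "norm ((LINT j|lebI. f j *\<^sub>R y n j) - (LINT j|lebI. s m j *\<^sub>R y n j)) \<le> e" for n
  proof -
    have "(LINT j|lebI. f j *\<^sub>R y n j) - (LINT j|lebI. s m j *\<^sub>R y n j)
        = (LINT j|lebI. (f j - s m j) *\<^sub>R y n j)"
      using integrable_scaleR[OF f bound(1)] integrable_scaleR[OF s bound(2)]
      by (simp add: scaleR_diff_left)
    moreover have "norm (LINT j|lebI. (f j - s m j) *\<^sub>R y n j) \<le> e"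
    proof (rule norm_integral_scaleR_le(2)[OF _ _ L2 norm_le_1 e])
      show "integrable lebI (\<lambda>j. (f j - s m j)\<^sup>2)"
        using B by (intro integrable_lebI_bounded[where B = "(2 * B)\<^sup>2"]) auto
    qed (use m in auto)
    ultimately show ?thesis by simp
  qed
  then show "\<exists>c. convergent c \<and> (\<forall>n. norm ((LINT j|lebI. f j *\<^sub>R y n j) - c n) \<le> e)"
    using tested[of m] unfolding tested_def by blast
qed

lemma tested_sum:
  assumes "finite A" and f: "\<And>i. i \<in> A \<Longrightarrow> f i \<in> borel_measurable lebI" "\<And>i j. i \<in> A \<Longrightarrow> \<bar>f i j\<bar> \<le> B"
    and tested: "\<And>i. i \<in> A \<Longrightarrow> tested (f i)"
  shows "tested (\<lambda>j. \<Sum>i\<in>A. c i * f i j)"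
proof -
  have int: "integrable lebI (\<lambda>j. c i *\<^sub>R (f i j *\<^sub>R y n j))" if "i \<in> A" for i n
    by (intro integrable_scaleR_right integrable_scaleR[OF f(1,2)[OF that]])
  have "(LINT j|lebI. (\<Sum>i\<in>A. c i * f i j) *\<^sub>R y n j) = (\<Sum>i\<in>A. c i *\<^sub>R (LINT j|lebI. f i j *\<^sub>R y n j))" for n
  proof -
    have "(LINT j|lebI. (\<Sum>i\<in>A. c i * f i j) *\<^sub>R y n j) = (LINT j|lebI. (\<Sum>i\<in>A. c i *\<^sub>R (f i j *\<^sub>R y n j)))"
      by (simp add: scaleR_sum_left)
    also have "\<dots> = (\<Sum>i\<in>A. (LINT j|lebI. c i *\<^sub>R (f i j *\<^sub>R y n j)))"
      by (rule Bochner_Integration.integral_sum[OF int])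
    finally show ?thesis by (simp only: integral_scaleR_right)
  qed
  moreover have "convergent (\<lambda>n. c i *\<^sub>R (LINT j|lebI. f i j *\<^sub>R y n j))" if "i \<in> A" for i
    using tested[OF that] unfolding tested_def convergent_def
    by (elim exE) (rule exI, rule tendsto_scaleR[OF tendsto_const])
  ultimately show ?thesis
    unfolding tested_def by (simp add: convergent_sum)
qed

text \<open>Dynkin's pi-lambda argument: complements follow by linearity, and countable disjoint
  unions are limits of finite ones.\<close>

lemma tested_borel_set:
  assumes gen: "A \<in> sigma_sets UNIV G" and G: "Int_stable G" "G \<subseteq> sets borel" "UNIV \<in> G"
    and tested: "\<And>A. A \<in> G \<Longrightarrow> tested (indicator A)"
  shows "tested (indicator A)"
proof -
  have borel: "A \<in> sets borel" if "A \<in> sigma_sets UNIV G" for A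
    using that G(2) sets.sigma_sets_subset[of G borel] by auto
  have meas: "indicator A \<in> borel_measurable lebI" if "A \<in> sigma_sets UNIV G" for A
    using borel[OF that] by (intro borel_measurable_lebI) simp
  have "G \<subseteq> Pow UNIV" by simp
  with G(1) show ?thesis
    using gen
  proof (induction rule: sigma_sets_induct_disjoint)
    case (basic A)
    then show ?case by (rule tested)
  next
    case empty
    then show ?case by (simp add: tested_def convergent_const)
  next
    case (compl A)
    have U: "UNIV \<in> sigma_sets UNIV G" using G(3) by auto
    \<comment> \<open>The indicator of the complement is a difference of two indicators, written as
      a sum over a two-element index set to fit \<open>tested_sum\<close>.\<close>
    have "tested (\<lambda>j. \<Sum>b\<in>{True, False}. (if b then 1 else -1) * (if b then indicator UNIV else indicator A) j)"
    proof (rule tested_sum[where B = 1])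
      show "(if b then indicator UNIV else indicator A) \<in> borel_measurable lebI" for b
        using meas[OF U] meas[OF compl(1)] by (cases b) simp_all
      show "\<bar>(if b then indicator UNIV else indicator A) j\<bar> \<le> (1::real)" for b j
        by (simp add: indicator_def)
      show "tested (if b then indicator UNIV else indicator A)" for b
        using tested[OF G(3)] compl(2) by (cases b) simp_all
    qed simp
    moreover have "(\<lambda>j. \<Sum>b\<in>{True, False}. (if b then 1 else -1) * (if b then indicator UNIV else indicator A) j)
        = (indicator (UNIV - A) :: real \<Rightarrow> real)"
      by (auto simp: indicator_def fun_eq_iff)
    ultimately show ?case by simp
  next
    case (union A)
    have "tested (indicator (\<Union>i<m. A i))" for m
    proof -
      have "tested (\<lambda>j. \<Sum>i\<in>{..<m}. 1 * indicator (A i) j)"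
      proof (rule tested_sum[where B = 1])
        show "indicator (A i) \<in> borel_measurable lebI" for i
          using union(2) by (intro meas) auto
        show "tested (indicator (A i))" for i by (rule union(3))
      qed (simp_all add: indicator_def)
      moreover have "disjoint_family_on A {..<m}"
        using union(1) by (rule disjoint_family_on_mono[rotated]) auto
      then have "(\<lambda>j. \<Sum>i\<in>{..<m}. 1 * indicator (A i) j) = (indicator (\<Union>i<m. A i) :: real \<Rightarrow> real)"
        by (simp add: indicator_UN_disjoint fun_eq_iff)
      ultimately show ?thesis by simp
    qed
    moreover have "(\<Union>i<m. A i) \<in> sets borel" "(\<Union>i. A i) \<in> sets borel" for m
      using union(2) borel by blast+
    ultimately show ?case
      by (intro tested_limit[of "indicator (\<Union>i. A i)" "\<lambda>m. indicator (\<Union>i<m. A i)" 1]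
          LIMSEQ_indicator_UN borel_measurable_lebI borel_measurable_indicator) (simp_all add: indicator_def)
  qed
qed

text \<open>Simple functions are finite combinations of indicators of their level sets. The
  approximation is dominated by twice \<open>f\<close>, which explains the uniform bound
  \<open>2 * B\<close>.\<close>

lemma tested_bounded_borel:
  assumes sets: "\<And>A. A \<in> sets borel \<Longrightarrow> tested (indicator A)"
    and f: "f \<in> borel_measurable borel" "\<And>j. \<bar>f j\<bar> \<le> B"
  shows "tested f"
proof -
  obtain F where F: "\<And>m. simple_function borel (F m)" "\<And>j. (\<lambda>m. F m j) \<longlonglongrightarrow> f j"
    "\<And>m j. norm (F m j) \<le> 2 * norm (f j)"
    using borel_measurable_implies_sequence_metric[OF f(1), of 0] by auto
  have "tested (F m)" for m
  proof -
    have fin: "finite (range (F m))" using F(1)[of m] by (simp add: simple_function_def)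
    have "F m -` {v} \<in> sets borel" for v
      using borel_measurable_simple_function[OF F(1)[of m]] by (simp add: in_borel_measurable_borel)
    then have "tested (\<lambda>j. \<Sum>v\<in>range (F m). v * indicator (F m -` {v}) j)"
      using fin by (intro tested_sum[where B = 1] sets borel_measurable_lebI borel_measurable_indicator)
        (auto simp: indicator_def)
    moreover have "(\<Sum>v\<in>range (F m). v * indicator (F m -` {v}) j) = F m j" for j
      using fin by (subst sum.remove[of _ "F m j"]) (auto intro!: sum.neutral simp: indicator_def)
    ultimately show ?thesis by simp
  qed
  moreover have "\<bar>f j\<bar> \<le> 2 * B" "\<bar>F m j\<bar> \<le> 2 * B" for m j
    using f(2)[of j] F(3)[of m j] by auto
  ultimately show ?thesis
    by (intro tested_limit[of f F "2 * B"] F(2) borel_measurable_lebI f(1) borel_measurable_simple_function[OF F(1)])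
qed

end

text \<open>The subsequence is selected by a diagonal argument on a countable generator alone; the
  preceding lemmas extend its convergence to every bounded Borel test function.\<close>

lemma (in unit_ball_sequence) weakly_convergent_subsequence:
  obtains r :: "nat \<Rightarrow> nat" where "strict_mono r"
    "\<And>f B. f \<in> borel_measurable borel \<Longrightarrow> (\<And>j. \<bar>f j\<bar> \<le> B) \<Longrightarrow>
      convergent (\<lambda>n. LINT j|lebI. f j *\<^sub>R y (r n) j)"
proof -
  obtain B :: "real set set" where B: "countable B" "topological_basis B"
    using ex_countable_basis by blast
  \<comment> \<open>Finite intersections of a countable basis remain countably many and become
    closed under intersection; the empty family contributes \<open>UNIV\<close>.\<close>
  define G where "G = Inter ` {F. finite F \<and> F \<subseteq> B}"
  have "countable G"
    unfolding G_def using B(1) by (intro countable_image countable_Collect_finite_subset)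
  have "Int_stable G"
  proof (rule Int_stableI)
    fix U V assume "U \<in> G" "V \<in> G"
    then obtain F F' where "U = \<Inter>F" "V = \<Inter>F'" "finite F" "finite F'" "F \<subseteq> B" "F' \<subseteq> B"
      by (auto simp: G_def)
    then have "U \<inter> V = \<Inter>(F \<union> F')" "finite (F \<union> F')" "F \<union> F' \<subseteq> B" by auto
    then show "U \<inter> V \<in> G" unfolding G_def by blast
  qed
  have "UNIV \<in> G" unfolding G_def by (intro image_eqI[of _ _ "{}"]) auto
  have G_borel: "G \<subseteq> sets borel"
  proof
    fix U assume "U \<in> G"
    then obtain F where "U = \<Inter>F" "finite F" "F \<subseteq> B" by (auto simp: G_def)
    then have "open U" using topological_basis_open[OF B(2)] by (auto intro!: open_Inter)
    then show "U \<in> sets borel" by simp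
  qed
  have "B \<subseteq> G" unfolding G_def by (auto intro!: image_eqI[of _ _ "{_}"])
  then have "sets borel \<subseteq> sigma_sets UNIV G"
    unfolding borel_eq_countable_basis[OF B] by (simp add: sigma_sets_mono')
  have bound: "norm (LINT j|lebI. indicator A j *\<^sub>R y n j) \<le> 1" if "A \<in> G" for n A
  proof (rule norm_integral_scaleR_le(2)[OF _ _ L2 norm_le_1])
    show m: "indicator A \<in> borel_measurable lebI"
      using that G_borel by (intro borel_measurable_lebI) auto
    show int: "integrable lebI (\<lambda>j. (indicator A j)\<^sup>2 :: real)"
      by (intro integrable_lebI_bounded[where B = 1] borel_measurable_power m) (simp add: indicator_def)
    have "(LINT j|lebI. (indicator A j)\<^sup>2 :: real) \<le> (LINT j|lebI. 1)"
      by (intro integral_mono int) (auto simp: indicator_def)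
    then show "(LINT j|lebI. (indicator A j)\<^sup>2) \<le> (1::real)\<^sup>2" using lebI.prob_space by simp
  qed simp
  obtain r :: "nat \<Rightarrow> nat" where r: "strict_mono r"
    "\<And>A. A \<in> G \<Longrightarrow> \<exists>l. (\<lambda>n. LINT j|lebI. indicator A j *\<^sub>R y (r n) j) \<longlonglongrightarrow> l"
    using function_convergent_subsequence[OF \<open>countable G\<close>, of "\<lambda>n A. LINT j|lebI. indicator A j *\<^sub>R y n j" 1]
      bound by blast
  interpret sub: unit_ball_sequence "\<lambda>n. y (r n)"
    by unfold_locales (auto simp: L2 norm_le_1)
  have "sub.tested (indicator A)" if "A \<in> G" for A
    using r(2)[OF that] by (auto simp: sub.tested_def convergent_def)
  then have "sub.tested (indicator A)" if "A \<in> sets borel" for A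
    using sub.tested_borel_set[OF _ \<open>Int_stable G\<close> G_borel \<open>UNIV \<in> G\<close>] that
      \<open>sets borel \<subseteq> sigma_sets UNIV G\<close> by blast
  then have "sub.tested f" if "f \<in> borel_measurable borel" "\<And>j. \<bar>f j\<bar> \<le> B" for f B
    using sub.tested_bounded_borel that by blast
  then show ?thesis
    using r(1) that[of r] unfolding sub.tested_def by blast
qed

section \<open>Positivity of the algebraic connectivity\<close>

context kernel
begin

lemma energy_scaleR: "energy w (\<lambda>i. c *\<^sub>R x i) = c\<^sup>2 * energy w x"
proof -
  have "w p * (norm (c *\<^sub>R x (fst p) - c *\<^sub>R x (snd p)))\<^sup>2 = c\<^sup>2 * (w p * (norm (x (fst p) - x (snd p)))\<^sup>2)" for p
    by (simp add: power_mult_distrib flip: scaleR_diff_right)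
  then show ?thesis unfolding energy_def by (simp only: integral_mult_right_zero)
qed

text \<open>An infimum that is at most \<open>0\<close> lies below each \<open>1 / Suc n\<close>, so
  there are competitors with such small quotients. They are normalised, and the energy of a unit
  vector is twice its quotient.\<close>

lemma lambda2_nonpos_sequence:
  assumes "\<not> lambda2 (graph_laplacian w :: (real \<Rightarrow> real ^ 'd) \<Rightarrow> _) > 0"
  obtains y :: "nat \<Rightarrow> real \<Rightarrow> real ^ 'd" where
    "\<And>n. y n \<in> L2I" "\<And>n. (LINT i|lebI. y n i) = 0" "\<And>n. (LINT i|lebI. (norm (y n i))\<^sup>2) = 1"
    "(\<lambda>n. energy w (y n)) \<longlonglongrightarrow> 0"
proof -
  let ?X = "{x :: real \<Rightarrow> real ^ 'd. x \<in> const_perp \<and> \<not> (AE i in lebI. x i = 0)}"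
  let ?R = "\<lambda>x :: real \<Rightarrow> real ^ 'd. innerL2 (graph_laplacian w x) x / (normL2 x)\<^sup>2"
  \<comment> \<open>Competitors can be extracted from the infimum only if there are any; the centred
    indicator of the left half is one.\<close>
  have "?X \<noteq> {}"
  proof -
    have S: "{0..1/2} \<in> sets lebI" by (simp add: sets_lebI_iff)
    have "measure lebI {0..1/2} = 1/2" by (simp add: measure_restrict_space)
    note x = cut_test_function[OF S, where 'd = 'd, unfolded this]
    define x where "x i = (indicator {0..1/2} i - 1/2) *\<^sub>R axis (undefined :: 'd) (1::real)" for i :: real
    have "x \<in> const_perp" "(LINT i|lebI. (norm (x i))\<^sup>2) \<noteq> 0"
      unfolding x_def x(2) by (rule x(1)) simp
    then have "x \<in> ?X" using L2I_AE_zero_iff[of x] by (simp add: const_perp_def)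
    then show ?thesis by blast
  qed
  have "\<exists>y :: real \<Rightarrow> real ^ 'd. y \<in> L2I \<and> (LINT i|lebI. y i) = 0 \<and> (LINT i|lebI. (norm (y i))\<^sup>2) = 1 \<and>
      energy w y \<le> 2 * inverse (real (Suc n))" for n
  proof -
    have less: "Inf (?R ` ?X) < inverse (real (Suc n))"
      using assms unfolding lambda2_def not_less by (rule le_less_trans) simp
    have "?R ` ?X \<noteq> {}" using \<open>?X \<noteq> {}\<close> by (simp only: image_is_empty not_False_eq_True)
    from cInf_lessD[OF this less] obtain v where v: "v \<in> ?R ` ?X" "v < inverse (real (Suc n))" ..
    from v(1) obtain x where x: "v = ?R x" "x \<in> ?X" by (rule imageE)
    note x = x(2) v(2)[unfolded x(1)]
    have L2: "x \<in> L2I" and mean: "(LINT i|lebI. x i) = 0" using x(1) by (auto simp: const_perp_eq)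
    let ?N = "LINT i|lebI. (norm (x i))\<^sup>2"
    have N: "?N > 0"
      using L2I_AE_zero_iff[OF L2] x(1) by (simp add: order_less_le)
    define y where "y i = (1 / sqrt ?N) *\<^sub>R x i" for i
    have sq: "(1 / sqrt ?N)\<^sup>2 = 1 / ?N" using N by (simp add: power_divide)
    have ny: "(norm (y i))\<^sup>2 = 1 / ?N * (norm (x i))\<^sup>2" for i
      unfolding y_def norm_scaleR power_mult_distrib power2_abs sq ..
    have "energy w y = 1 / ?N * energy w x"
      unfolding y_def energy_scaleR sq ..
    also have "\<dots> = 2 * ?R x"
      using inner_graph_laplacian[OF L2] by (simp add: normL2_square)
    finally have "energy w y \<le> 2 * inverse (real (Suc n))" using x(2) by simp
    moreover have "y \<in> borel_measurable lebI"
      using L2I_measurable[OF L2] unfolding y_def by (intro borel_measurable_scaleR) simp_all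
    then have "y \<in> L2I"
      using L2 unfolding L2I_def mem_Collect_eq ny by simp
    moreover have "(LINT i|lebI. y i) = 0" by (simp add: y_def mean)
    moreover have "(LINT i|lebI. (norm (y i))\<^sup>2) = 1"
      unfolding ny using N by simp
    ultimately show ?thesis by (intro exI[of _ y] conjI)
  qed
  from choice[OF allI[OF this]] obtain y :: "nat \<Rightarrow> real \<Rightarrow> real ^ 'd" where
    "\<forall>n. y n \<in> L2I \<and> (LINT i|lebI. y n i) = 0 \<and> (LINT i|lebI. (norm (y n i))\<^sup>2) = 1 \<and>
      energy w (y n) \<le> 2 * inverse (real (Suc n))" ..
  then have y: "y n \<in> L2I" "(LINT i|lebI. y n i) = 0" "(LINT i|lebI. (norm (y n i))\<^sup>2) = 1"
    "energy w (y n) \<le> 2 * inverse (real (Suc n))" for n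
    by blast+
  have lim: "(\<lambda>n. 2 * inverse (real (Suc n))) \<longlonglongrightarrow> 0"
    by (rule tendsto_mult_right_zero[OF LIMSEQ_inverse_real_of_nat])
  have "(\<lambda>n. energy w (y n)) \<longlonglongrightarrow> 0"
    by (rule tendsto_sandwich[OF always_eventually always_eventually tendsto_const lim])
      (intro allI energy_nonneg y(4))+
  then show ?thesis by (rule that[OF y(1-3)])
qed

theorem lambda2_pos_if_irreducible:
  assumes irr: "irreducible_kernel w" and \<delta>: "\<delta> > 0" "AE i in lebI. \<delta> \<le> vertex_degree w i"
  shows "lambda2 (graph_laplacian w :: (real \<Rightarrow> real ^ 'd) \<Rightarrow> _) > 0"
proof (rule ccontr)
  assume "\<not> ?thesis"
  then obtain y :: "nat \<Rightarrow> real \<Rightarrow> real ^ 'd" where y: "\<And>n. y n \<in> L2I" "\<And>n. (LINT i|lebI. y n i) = 0"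
    "\<And>n. (LINT i|lebI. (norm (y n i))\<^sup>2) = 1" "(\<lambda>n. energy w (y n)) \<longlonglongrightarrow> 0"
    by (rule lambda2_nonpos_sequence) blast
  interpret unit_ball_sequence y by unfold_locales (simp_all add: y)
  obtain r where r: "strict_mono r"
    and conv: "\<And>f B. f \<in> borel_measurable borel \<Longrightarrow> (\<And>j. \<bar>f j\<bar> \<le> B) \<Longrightarrow>
      convergent (\<lambda>n. LINT j|lebI. f j *\<^sub>R y (r n) j)"
    using weakly_convergent_subsequence by blast
  define z where "z n = y (r n)" for n
  have z: "z n \<in> L2I" "(LINT i|lebI. z n i) = 0" "(LINT i|lebI. (norm (z n i))\<^sup>2) = 1" for n
    by (simp_all add: z_def y)
  have [measurable]: "z n \<in> borel_measurable lebI" for n by (rule L2I_measurable[OF z(1)])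
  have Ez: "(\<lambda>n. energy w (z n)) \<longlonglongrightarrow> 0"
    using LIMSEQ_subseq_LIMSEQ[OF y(4) r] by (simp add: z_def o_def)
  define A where "A n i = (LINT j|lebI. w (i, j) *\<^sub>R z n j)" for n i
  have [measurable]: "A n \<in> borel_measurable lebI" for n
  proof -
    have "(\<lambda>i. LINT j|lebI. w (i, j) *\<^sub>R z n j) \<in> borel_measurable lebI" by measurable
    then show ?thesis by (simp add: A_def[abs_def])
  qed
  \<comment> \<open>Each section of \<open>w\<close> is a bounded Borel test function, so
    \<open>A n i\<close> converges at every \<open>i\<close>. Together with the uniform bound
    \<open>1\<close> this gives L2 convergence, which is the compactness of the adjacency
    operator.\<close>
  define v where "v i = lim (\<lambda>n. A n i)" for i
  have v: "(\<lambda>n. A n i) \<longlonglongrightarrow> v i" for i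
    using conv[OF section_borel, of i 1] nonneg le_1
    by (simp add: v_def A_def z_def convergent_LIMSEQ_iff abs_of_nonneg)
  have A1: "norm (A n i) \<le> 1" for n i
  proof (unfold A_def, rule norm_integral_scaleR_le(2)[OF _ _ z(1)])
    show int: "integrable lebI (\<lambda>j. (w (i, j))\<^sup>2)"
      using nonneg le_1 by (intro integrable_lebI_bounded[where B = 1]) (auto simp: power_le_one)
    have "(LINT j|lebI. (w (i, j))\<^sup>2) \<le> (LINT j|lebI. 1)"
      using nonneg le_1 by (intro integral_mono int) (auto simp: power_le_one)
    then show "(LINT j|lebI. (w (i, j))\<^sup>2) \<le> 1\<^sup>2" using lebI.prob_space by simp
  qed (simp_all add: z)
  have v1: "norm (v i) \<le> 1" for i
    by (rule LIMSEQ_le_const2[OF tendsto_norm[OF v]]) (use A1 in auto)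
  have [measurable]: "v \<in> borel_measurable lebI"
    by (rule borel_measurable_LIMSEQ_metric[where f = A]) (auto intro: v)
  have L: "graph_laplacian w (z n) i = vertex_degree w i *\<^sub>R z n i - A n i" for n i
    using integrable_section[of i] integrable_section_mult[OF L2I_integrable[OF z(1)], of i n]
    by (simp add: graph_laplacian_def vertex_degree_def A_def scaleR_diff_right)
  have intA: "integrable lebI (\<lambda>i. (norm (A n i - v i))\<^sup>2)" for n
  proof (rule integrable_lebI_bounded[where B = 4])
    show "norm ((norm (A n i - v i))\<^sup>2) \<le> 4" for i
      using power_mono[of "norm (A n i - v i)" 2 2] norm_triangle_ineq4[of "A n i" "v i"] A1[of n i] v1[of i]
      by simp
  qed measurable
  have "(\<lambda>n. LINT i|lebI. (norm (A n i - v i))\<^sup>2) \<longlonglongrightarrow> (LINT i|lebI. 0)"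
  proof (rule integral_dominated_convergence[where w = "\<lambda>_. 4"])
    have "(\<lambda>n. (norm (A n i - v i))\<^sup>2) \<longlonglongrightarrow> (norm (v i - v i))\<^sup>2" for i
      by (intro tendsto_intros v)
    then show "AE i in lebI. (\<lambda>n. (norm (A n i - v i))\<^sup>2) \<longlonglongrightarrow> 0" by simp
    have "norm ((norm (A n i - v i))\<^sup>2) \<le> 4" for n i
      using power_mono[of "norm (A n i - v i)" 2 2] norm_triangle_ineq4[of "A n i" "v i"] A1[of n i] v1[of i]
      by simp
    then show "AE i in lebI. norm ((norm (A n i - v i))\<^sup>2) \<le> 4" for n by simp
  qed auto
  then have Av: "(\<lambda>n. LINT i|lebI. (norm (A n i - v i))\<^sup>2) \<longlonglongrightarrow> 0" by simp
  \<comment> \<open>The Laplacian of \<open>z n\<close> is the degree times \<open>z n\<close> minus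
    \<open>A n\<close>. As it tends to zero, the only possible limit of \<open>z n\<close> is
    \<open>v\<close> divided by the degree.\<close>
  define x where "x i = (1 / vertex_degree w i) *\<^sub>R v i" for i
  have [measurable]: "x \<in> borel_measurable lebI" unfolding x_def by measurable
  have x: "x \<in> L2I"
    unfolding L2I_def mem_Collect_eq
  proof
    show "integrable lebI (\<lambda>i. (norm (x i))\<^sup>2)"
    proof (rule lebI.integrable_const_bound[where B = "(1 / \<delta>)\<^sup>2"])
      show "AE i in lebI. norm ((norm (x i))\<^sup>2) \<le> (1 / \<delta>)\<^sup>2"
        using \<delta>(2)
      proof eventually_elim
        case (elim i)
        then have "norm (x i) \<le> 1 / \<delta>"
          using \<delta>(1) v1[of i] by (simp add: x_def frac_le)
        then show ?case by (simp add: power_mono)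
      qed
    qed measurable
  qed measurable
  define D where "D n = (LINT i|lebI. (norm (z n i - x i))\<^sup>2)" for n
  note int_zx = L2I_square_integrable[OF L2I_diff[OF z(1) x]]
  have D_nonneg: "0 \<le> D n" for n by (simp add: D_def)
  have D_le: "\<delta>\<^sup>2 * D n \<le> 2 * energy w (z n) + 2 * (LINT i|lebI. (norm (A n i - v i))\<^sup>2)" for n
  proof -
    have "\<delta>\<^sup>2 * D n = (LINT i|lebI. \<delta>\<^sup>2 * (norm (z n i - x i))\<^sup>2)" by (simp add: D_def)
    also have "\<dots> \<le> (LINT i|lebI. 2 * (norm (graph_laplacian w (z n) i))\<^sup>2 + 2 * (norm (A n i - v i))\<^sup>2)"
    proof (rule integral_mono_AE)
      show "integrable lebI (\<lambda>i. \<delta>\<^sup>2 * (norm (z n i - x i))\<^sup>2)" using int_zx by simp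
      show "integrable lebI (\<lambda>i. 2 * (norm (graph_laplacian w (z n) i))\<^sup>2 + 2 * (norm (A n i - v i))\<^sup>2)"
        using graph_laplacian_square_le(1)[OF z(1)] intA by simp
      show "AE i in lebI. \<delta>\<^sup>2 * (norm (z n i - x i))\<^sup>2
          \<le> 2 * (norm (graph_laplacian w (z n) i))\<^sup>2 + 2 * (norm (A n i - v i))\<^sup>2"
        using \<delta>(2)
      proof eventually_elim
        case (elim i)
        \<comment> \<open>Dividing this identity by the degree, which is at least
          \<open>\<delta>\<close>, controls \<open>z n - x\<close> by two terms that tend to zero in
          L2.\<close>
        have "vertex_degree w i *\<^sub>R (z n i - x i) = graph_laplacian w (z n) i - (v i - A n i)"
          using elim \<delta>(1) by (simp add: L x_def scaleR_diff_right)
        then have "(vertex_degree w i * norm (z n i - x i))\<^sup>2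
            \<le> 2 * (norm (graph_laplacian w (z n) i))\<^sup>2 + 2 * (norm (v i - A n i))\<^sup>2"
          using norm_diff_square_le[of "graph_laplacian w (z n) i" "v i - A n i"] degree_nonneg[of i]
          by (metis abs_of_nonneg norm_scaleR)
        moreover have "(\<delta> * norm (z n i - x i))\<^sup>2 \<le> (vertex_degree w i * norm (z n i - x i))\<^sup>2"
          using elim \<delta>(1) by (intro power_mono mult_right_mono) auto
        ultimately show ?case by (simp add: power_mult_distrib norm_minus_commute)
      qed
    qed
    also have "\<dots> \<le> 2 * energy w (z n) + 2 * (LINT i|lebI. (norm (A n i - v i))\<^sup>2)"
      using graph_laplacian_square_le[OF z(1)] intA by simp
    finally show ?thesis .
  qed
  have "(\<lambda>n. 2 * energy w (z n) + 2 * (LINT i|lebI. (norm (A n i - v i))\<^sup>2)) \<longlonglongrightarrow> 2 * 0 + 2 * 0"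
    by (intro tendsto_intros Ez Av)
  then have lim: "(\<lambda>n. 2 * energy w (z n) + 2 * (LINT i|lebI. (norm (A n i - v i))\<^sup>2)) \<longlonglongrightarrow> 0"
    by (simp only: mult_zero_right add_0_left)
  have "(\<lambda>n. \<delta>\<^sup>2 * D n) \<longlonglongrightarrow> 0"
    by (rule tendsto_sandwich[OF always_eventually always_eventually tendsto_const lim])
      (intro allI mult_nonneg_nonneg zero_le_power2 D_nonneg D_le)+
  from tendsto_mult[OF tendsto_const[of "1 / \<delta>\<^sup>2"] this] have D: "D \<longlonglongrightarrow> 0"
    using \<delta>(1) by simp
  have "energy w x \<le> 0"
  proof (rule LIMSEQ_le_const)
    have "(\<lambda>n. 2 * energy w (z n) + 8 * D n) \<longlonglongrightarrow> 2 * 0 + 8 * 0"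
      by (intro tendsto_intros Ez D)
    then show "(\<lambda>n. 2 * energy w (z n) + 8 * D n) \<longlonglongrightarrow> 0" by simp
    show "\<exists>N. \<forall>n\<ge>N. energy w x \<le> 2 * energy w (z n) + 8 * D n"
      using energy_le[OF x z(1)] by (simp add: D_def norm_minus_commute)
  qed
  then have E: "energy w x = 0" using energy_nonneg[of x] by simp
  have "(norm (LINT i|lebI. x i))\<^sup>2 \<le> 0"
  proof (rule LIMSEQ_le_const[OF D], intro exI allI impI)
    fix n
    have "(norm (LINT i|lebI. z n i - x i))\<^sup>2 \<le> D n"
      unfolding D_def by (rule lebI.norm_integral_square_le(2)[OF _ int_zx]) measurable
    then show "(norm (LINT i|lebI. x i))\<^sup>2 \<le> D n"
      using L2I_integrable[OF z(1)] L2I_integrable[OF x] z(2) by simp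
  qed
  then have mean: "(LINT i|lebI. x i) = 0" by simp
  have "AE i in lebI. x i = 0" by (rule AE_zero_if_energy_zero[OF irr x E mean])
  \<comment> \<open>If the limit vanishes, the distance from \<open>z n\<close> to it is the norm
    \<open>1\<close>, contradicting strong convergence.\<close>
  then have "D n = (LINT i|lebI. (norm (z n i))\<^sup>2)" for n
    unfolding D_def by (intro integral_cong_AE) auto
  then have "D = (\<lambda>_. 1)" using z(3) by auto
  with D show False by (simp add: LIMSEQ_const_iff)
qed

end

section \<open>Chains\<close>

lemma AE_lebesgue_on_Diff_null:
  assumes N: "N \<in> null_sets lebesgue"
  shows "(AE i in lebesgue_on ({0..1::real} - N). P i) \<longleftrightarrow> (AE i in lebI. P i)"
proof -
  have "N \<in> sets lebesgue" using N by auto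
  then have "(AE i in lebesgue_on ({0..1} - N). P i) \<longleftrightarrow> (AE i in lebesgue. i \<in> {0..1} - N \<longrightarrow> P i)"
    by (subst AE_restrict_space_iff) auto
  also have "\<dots> \<longleftrightarrow> (AE i in lebesgue. i \<in> {0..1} \<longrightarrow> P i)"
    using AE_not_in[OF N] by (auto elim: AE_mp)
  also have "\<dots> \<longleftrightarrow> (AE i in lebI. P i)"
    by (subst AE_restrict_space_iff) auto
  finally show ?thesis .
qed

lemma AE_witness:
  "AE x in M. P x \<Longrightarrow> \<not> (AE x in M. Q x) \<Longrightarrow> \<exists>x. P x \<and> \<not> Q x"
  by (metis (mono_tags, lifting) eventually_mono)

lemma AE_lebI_not_in_null:
  "N \<in> null_sets lebesgue \<Longrightarrow> AE i in lebI. i \<notin> N"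
  by (subst AE_lebesgue_on_Diff_null[symmetric]) (auto intro!: AE_I2 simp: space_restrict_space)

text \<open>All quantifiers range over \<open>nat\<close>, so the set on which a sequence of
  measurable functions tends to zero is visibly measurable.\<close>

lemma LIMSEQ_zero_iff_nat:
  fixes X :: "nat \<Rightarrow> real"
  shows "X \<longlonglongrightarrow> 0 \<longleftrightarrow> (\<forall>k. \<exists>N. \<forall>n. N \<le> n \<longrightarrow> \<bar>X n\<bar> < inverse (real (Suc k)))"
proof
  assume "X \<longlonglongrightarrow> 0"
  then show "\<forall>k. \<exists>N. \<forall>n. N \<le> n \<longrightarrow> \<bar>X n\<bar> < inverse (real (Suc k))"
    unfolding LIMSEQ_iff by (metis diff_zero inverse_positive_iff_positive of_nat_0_less_iff real_norm_def zero_less_Suc)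
next
  assume *: "\<forall>k. \<exists>N. \<forall>n. N \<le> n \<longrightarrow> \<bar>X n\<bar> < inverse (real (Suc k))"
  show "X \<longlonglongrightarrow> 0"
  proof (rule LIMSEQ_I)
    fix e :: real assume "e > 0"
    then obtain k where "inverse (real (Suc k)) < e" using reals_Archimedean by blast
    moreover obtain N where "\<And>n. N \<le> n \<Longrightarrow> \<bar>X n\<bar> < inverse (real (Suc k))" using * by blast
    ultimately have "norm (X n - 0) < e" if "N \<le> n" for n using that by fastforce
    then show "\<exists>N. \<forall>n\<ge>N. norm (X n - 0) < e" by blast
  qed
qed

lemma chain_leaves_set:
  fixes l :: "nat \<Rightarrow> 'a"
  assumes "1 \<le> m" "l 1 \<in> S" "l m \<notin> S"
  shows "\<exists>k\<in>{1..<m}. l k \<in> S \<and> l (k + 1) \<notin> S"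
proof (rule ccontr)
  assume *: "\<not> ?thesis"
  have "k \<le> m \<longrightarrow> l k \<in> S" if "1 \<le> k" for k
    using that by (induction k rule: dec_induct) (use * assms(2) in auto)
  with assms show False by auto
qed

lemma chain_if_rtranclp:
  assumes "R\<^sup>*\<^sup>* i j" "i \<in> J" and R: "\<And>l k. R l k \<Longrightarrow> k \<in> J"
  shows "\<exists>m\<ge>1. \<exists>l :: nat \<Rightarrow> 'a. (\<forall>k\<in>{1..m}. l k \<in> J) \<and> l 1 = i \<and> l m = j \<and>
    (\<forall>k\<in>{1..<m}. R (l k) (l (k + 1)))"
  using assms(1)
proof (induction rule: rtranclp_induct)
  case base
  show ?case by (rule exI[of _ 1]) (use \<open>i \<in> J\<close> in auto)
next
  case (step j j')
  from step.IH show ?case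
  proof (elim exE conjE)
    fix m :: nat and l :: "nat \<Rightarrow> 'a"
    assume ml: "1 \<le> m" "\<forall>k\<in>{1..m}. l k \<in> J" "l 1 = i" "l m = j"
      "\<forall>k\<in>{1..<m}. R (l k) (l (k + 1))"
    show ?case
      by (rule exI[of _ "Suc m"], intro conjI, simp, rule exI[of _ "l(Suc m := j')"])
        (use ml step.hyps(2) R[OF step.hyps(2)] in \<open>auto simp: le_Suc_eq less_Suc_eq\<close>)
  qed
qed

lemma (in kernel) AE_osc_section: "AE l in lebI. AE j in lebI. osc (\<lambda>y. w (l, y)) j \<longlonglongrightarrow> 0"
  by (intro AE_I2 AE_osc_tendsto_0 measurable_section range)

text \<open>The quantifiers are exchanged relative to \<open>AE_osc_section\<close>. A chain has to
  arrive at a given point \<open>j\<close>, so \<open>j\<close> must be a Lebesgue point for almost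
  every possible predecessor \<open>l\<close>.\<close>

lemma (in kernel) AE_osc_section': "AE j in lebI. AE l in lebI. osc (\<lambda>y. w (l, y)) j \<longlonglongrightarrow> 0"
proof -
  have id: "(\<lambda>x. x) \<in> lebI \<rightarrow>\<^sub>M borel"
    by (intro measurable_restrict_space1 measurable_completion) simp
  have osc_meas [measurable]: "(\<lambda>p. osc (\<lambda>y. w (fst p, y)) (snd p) n) \<in> borel_measurable lebII" for n
  proof -
    let ?r = "1 / real (Suc n)"
    have [measurable]: "(\<lambda>q. snd (fst q)) \<in> borel_measurable (lebII \<Otimes>\<^sub>M lebI)"
      by (rule measurable_compose[OF _ id]) measurable
    have [measurable]: "(\<lambda>q. snd q) \<in> borel_measurable (lebII \<Otimes>\<^sub>M lebI)"
      by (rule measurable_compose[OF _ id]) measurable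
    \<comment> \<open>Expressing the ball through the distance makes the integrand jointly
      measurable in section, centre and integration variable.\<close>
    have "(\<lambda>q. (if dist (snd (fst q)) (snd q) < ?r then 1 else 0) * \<bar>w (fst (fst q), snd q) - w (fst (fst q), snd (fst q))\<bar>)
        \<in> borel_measurable (lebII \<Otimes>\<^sub>M lebI)"
      by measurable
    then have "(\<lambda>p. LINT y|lebI. (if dist (snd p) y < ?r then 1 else 0) * \<bar>w (fst p, y) - w (fst p, snd p)\<bar>)
        \<in> borel_measurable lebII"
      by (intro lebI.borel_measurable_lebesgue_integral) (simp add: case_prod_beta')
    moreover have "indicator (ball j ?r) y = (if dist j y < ?r then 1 else 0 :: real)" for j y :: real
      by (simp add: indicator_def)
    ultimately show ?thesis unfolding osc_def by simp
  qed
  have "{p \<in> space lebII. osc (\<lambda>y. w (fst p, y)) (snd p) \<longlonglongrightarrow> 0} \<in> sets lebII"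
    unfolding LIMSEQ_zero_iff_nat by measurable
  then show ?thesis
    using AE_osc_section by (subst lebI2.AE_commute[symmetric])
qed

text \<open>\<open>a\<close> is tied to \<open>w\<close> only by equality almost everywhere, because
  a Lebesgue measurable function on the square is in general not measurable for the product
  \<open>lebII\<close>.\<close>

locale kernel_version = kernel w for w :: "real \<times> real \<Rightarrow> real" +
  fixes a :: "real \<times> real \<Rightarrow> real"
  assumes eq: "AE p in lebII. a p = w p"
begin

lemma section_eq: "AE i in lebI. AE j in lebI. a (i, j) = w (i, j)"
  using lebI2.AE_pair[OF eq] by simp

lemma section_eq': "AE j in lebI. AE i in lebI. a (i, j) = w (i, j)"
  using lebI2.AE_pair_swap[OF eq] by simp

lemma degree_eq: "AE i in lebI. vertex_degree a i = vertex_degree w i"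
  using section_eq
proof eventually_elim
  case (elim i)
  then have "AE j in lebI. w (i, j) = a (i, j)" by eventually_elim simp
  from lebI.integral_cong_AE_left[OF measurable_section this]
  show ?case by (simp add: vertex_degree_def)
qed

lemma lambda2_eq:
  "lambda2 (graph_laplacian a :: (real \<Rightarrow> real ^ 'd) \<Rightarrow> _) = lambda2 (graph_laplacian w :: (real \<Rightarrow> real ^ 'd) \<Rightarrow> _)"
proof -
  have "innerL2 (graph_laplacian a x) x = innerL2 (graph_laplacian w x) x"
    if x: "x \<in> L2I" for x :: "real \<Rightarrow> real ^ 'd"
  proof -
    have [measurable]: "x \<in> borel_measurable lebI" by (rule L2I_measurable[OF x])
    have "AE i in lebI. graph_laplacian w x i \<bullet> x i = graph_laplacian a x i \<bullet> x i"
      using section_eq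
    proof eventually_elim
      case (elim i)
      then have "AE j in lebI. w (i, j) *\<^sub>R (x i - x j) = a (i, j) *\<^sub>R (x i - x j)"
        by eventually_elim simp
      then have "graph_laplacian w x i = graph_laplacian a x i"
        unfolding graph_laplacian_def by (intro lebI.integral_cong_AE_left) measurable
      then show ?case by simp
    qed
    then show ?thesis
      unfolding innerL2_def by (intro lebI.integral_cong_AE_left[symmetric]) measurable
  qed
  then show ?thesis
    unfolding lambda2_def by (intro INF_cong) (auto simp: const_perp_def)
qed

lemma lebesgue_point_section:
  assumes "AE y in lebI. a (l, y) = w (l, y)" "a (l, j) = w (l, j)" "j \<in> {0..1}"
    and "osc (\<lambda>y. w (l, y)) j \<longlonglongrightarrow> 0"
  shows "lebesgue_point (\<lambda>y. a (l, y)) j"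
proof -
  have "lebesgue_point (\<lambda>y. w (l, y)) j"
    using assms(3,4) by (intro lebesgue_point_if_osc integrable_section)
  moreover have "AE y in lebI. w (l, y) = a (l, y)" using assms(1) by eventually_elim simp
  ultimately show ?thesis
    using assms(2) lebesgue_point_cong_AE[OF measurable_section, of l "\<lambda>y. a (l, y)" j] by simp
qed

theorem irreducible_kernel_if_chain_connected:
  assumes chain: "\<And>N\<^sub>0. N\<^sub>0 \<in> null_sets lebesgue \<Longrightarrow>
    \<exists>N \<in> null_sets lebesgue. N\<^sub>0 \<subseteq> N \<and> chain_connected_on ({0..1} - N) a"
  shows "irreducible_kernel w"
  unfolding irreducible_kernel_def
proof (intro ballI impI, rule ccontr)
  fix S assume S: "S \<in> sets lebI"
    and zero: "AE i in lebI. AE j in lebI. i \<in> S \<longrightarrow> j \<notin> S \<longrightarrow> w (i, j) = 0"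
    and "\<not> ((AE i in lebI. i \<in> S) \<or> (AE i in lebI. i \<notin> S))"
  then have neg: "\<not> (AE i in lebI. i \<in> S)" "\<not> (AE i in lebI. i \<notin> S)" by auto
  define C where "C = {0..1} - S"
  have C: "C \<in> sets lebI" using sets.compl_sets[OF S] by (simp add: C_def)
  define good where "good i \<longleftrightarrow> (AE y in lebI. i \<in> S \<longrightarrow> y \<in> C \<longrightarrow> a (i, y) = 0) \<and>
    (AE y in lebI. lebesgue_point (\<lambda>y. a (i, y)) y)" for i
  have "AE i in lebI. good i"
    using section_eq zero AE_osc_section
  proof eventually_elim
    case (elim i)
    have "AE y in lebI. i \<in> S \<longrightarrow> y \<in> C \<longrightarrow> a (i, y) = 0"
      using elim(1,2) by eventually_elim (auto simp: C_def)
    moreover have "AE y in lebI. y \<in> {0..1}" by (rule AE_I2) simp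
    then have "AE y in lebI. lebesgue_point (\<lambda>y. a (i, y)) y"
      using elim(1,3)
    proof eventually_elim
      case (elim y)
      then show ?case using \<open>AE j in lebI. a (i, j) = w (i, j)\<close> by (intro lebesgue_point_section)
    qed
    ultimately show ?case by (simp add: good_def)
  qed
  then have "{i \<in> {0..1}. \<not> good i} \<in> null_sets lebesgue" by (simp add: AE_lebI_iff)
  moreover have "C - density_points C \<in> null_sets lebesgue"
    using C by (simp add: sets_lebI_iff Lebesgue_density flip: negligible_iff_null_sets)
  ultimately have "{i \<in> {0..1}. \<not> good i} \<union> (C - density_points C) \<in> null_sets lebesgue"
    by (rule null_sets.Un)
  \<comment> \<open>This is where the freedom to prescribe a null set enters: every vertex of a
    chain in the remaining set is good, and is a density point of \<open>C\<close> if it lies in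
    \<open>C\<close>.\<close>
  then obtain N where N: "N \<in> null_sets lebesgue" "{i \<in> {0..1}. \<not> good i} \<union> (C - density_points C) \<subseteq> N"
    "chain_connected_on ({0..1} - N) a"
    using chain by meson
  let ?J = "{0..1} - N"
  let ?chain = "\<lambda>i j. \<exists>m\<ge>(1::nat). \<exists>l :: nat \<Rightarrow> real.
         (\<forall>k \<in> {1..m}. l k \<in> ?J) \<and> l 1 = i \<and> l m = j \<and>
         (\<forall>k \<in> {1..<m}. l (k + 1) \<in> support_on {0..1} (\<lambda>y. a (l k, y)) \<and>
                         lebesgue_point (\<lambda>y. a (l k, y)) (l (k + 1)))"
  have I: "AE i in lebI. i \<in> {0..1}" by (rule AE_I2) simp
  have J: "AE i in lebI. i \<in> ?J"
    using I AE_lebI_not_in_null[OF N(1)] by eventually_elim simp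
  have "AE i in lebI. \<forall>j \<in> ?J - {i}. lebesgue_point (\<lambda>y. a (i, y)) j \<longrightarrow> ?chain i j"
    using N(3) unfolding chain_connected_on_def AE_lebesgue_on_Diff_null[OF N(1)] .
  with J have AE_i: "AE i in lebI. i \<in> ?J \<and> (\<forall>j \<in> ?J - {i}. lebesgue_point (\<lambda>y. a (i, y)) j \<longrightarrow> ?chain i j)"
    by eventually_elim simp
  \<comment> \<open>Neither \<open>S\<close> nor its complement is null, so generic endpoints exist
    on both sides of the cut and are joined by a chain.\<close>
  from AE_witness[OF AE_i neg(2)] obtain i where
    "(i \<in> ?J \<and> (\<forall>j \<in> ?J - {i}. lebesgue_point (\<lambda>y. a (i, y)) j \<longrightarrow> ?chain i j)) \<and> \<not> i \<notin> S" ..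
  then have i: "i \<in> S" "i \<in> ?J" "\<forall>j \<in> ?J - {i}. lebesgue_point (\<lambda>y. a (i, y)) j \<longrightarrow> ?chain i j"
    by simp_all
  have "good i" using i(2) N(2) by auto
  then have "AE j in lebI. lebesgue_point (\<lambda>y. a (i, y)) j" by (simp add: good_def)
  with J have AE_j: "AE j in lebI. j \<in> ?J \<and> lebesgue_point (\<lambda>y. a (i, y)) j"
    by eventually_elim simp
  obtain j where j: "j \<notin> S" "j \<in> ?J" "lebesgue_point (\<lambda>y. a (i, y)) j"
    using AE_witness[OF AE_j neg(1)] by blast
  have "j \<in> ?J - {i}" using i(1) j(1,2) by auto
  from i(3)[THEN bspec, OF this, THEN mp, OF j(3)] show False
  proof (elim exE conjE)
    fix m :: nat and l :: "nat \<Rightarrow> real"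
    assume l: "1 \<le> m" "\<forall>k\<in>{1..m}. l k \<in> ?J" "l 1 = i" "l m = j"
      "\<forall>k\<in>{1..<m}. l (k + 1) \<in> support_on {0..1} (\<lambda>y. a (l k, y)) \<and>
        lebesgue_point (\<lambda>y. a (l k, y)) (l (k + 1))"
    obtain k where k: "k \<in> {1..<m}" "l k \<in> S" "l (k + 1) \<notin> S"
      using chain_leaves_set[of m l S] l(1,3,4) i(1) j(1) by auto
    then have "l k \<in> ?J" "l (k + 1) \<in> ?J" using l(2) by auto
    then have "good (l k)" and dens: "l (k + 1) \<in> density_points C"
      using N(2) k(3) by (auto simp: C_def)
    then have "AE y in lebI. y \<in> C \<longrightarrow> a (l k, y) = 0"
      using k(2) by (simp add: good_def)
    \<comment> \<open>The crossing edge ends at a density point of \<open>C\<close>, almost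
      everywhere on which the section vanishes. Being a Lebesgue point it must carry the value
      \<open>0\<close>, against membership in the support.\<close>
    then have "a (l k, l (k + 1)) = 0"
      using lebesgue_point_eq_0[OF _ C dens] l(5) k(1) by blast
    then show False using l(5) k(1) by (simp add: support_on_def)
  qed
qed

theorem chain_connected_if_irreducible:
  assumes irr: "irreducible_kernel w" and deg: "AE i in lebI. 0 < vertex_degree w i"
    and N\<^sub>0: "N\<^sub>0 \<in> null_sets lebesgue"
  shows "\<exists>N \<in> null_sets lebesgue. N\<^sub>0 \<subseteq> N \<and> chain_connected_on ({0..1} - N) a"
proof -
  \<comment> \<open>Goodness of the target \<open>k\<close> ensures that, for almost every
    \<open>l\<close>, a nonzero \<open>w (l, k)\<close> is an admissible edge for \<open>a\<close>,
    and that there are enough such \<open>l\<close>.\<close>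
  define good where "good k \<longleftrightarrow> 0 < vertex_degree w k \<and> (AE l in lebI. (AE y in lebI. a (l, y) = w (l, y)) \<and>
    a (l, k) = w (l, k) \<and> osc (\<lambda>y. w (l, y)) k \<longlonglongrightarrow> 0)" for k
  have "AE k in lebI. good k"
    using deg section_eq' AE_osc_section'
  proof eventually_elim
    case (elim k)
    have "AE l in lebI. (AE y in lebI. a (l, y) = w (l, y)) \<and> a (l, k) = w (l, k) \<and> osc (\<lambda>y. w (l, y)) k \<longlonglongrightarrow> 0"
      using section_eq elim(2,3) by eventually_elim simp
    with elim(1) show ?case by (simp add: good_def)
  qed
  then have "{k \<in> {0..1}. \<not> good k} \<in> null_sets lebesgue" by (simp add: AE_lebI_iff)
  define N where "N = N\<^sub>0 \<union> {k \<in> {0..1}. \<not> good k}"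
  have N: "N \<in> null_sets lebesgue"
    unfolding N_def by (rule null_sets.Un) fact+
  define J where "J = {0..1} - N"
  have J_sets: "J \<in> sets lebI" using N by (auto simp: J_def sets_lebI_iff)
  have J_good: "good k" "k \<in> {0..1}" if "k \<in> J" for k using that by (auto simp: J_def N_def)
  have I: "AE i in lebI. i \<in> {0..1}" by (rule AE_I2) simp
  have J: "AE i in lebI. i \<in> J"
    using I AE_lebI_not_in_null[OF N] by eventually_elim (simp add: J_def)
  define step where "step l k \<longleftrightarrow> k \<in> J \<and> k \<in> support_on {0..1} (\<lambda>y. a (l, y)) \<and>
    lebesgue_point (\<lambda>y. a (l, y)) k" for l k
  have step: "AE l in lebI. w (l, k) \<noteq> 0 \<longrightarrow> step l k" if k: "k \<in> J" for k
  proof -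
    have "AE l in lebI. (AE y in lebI. a (l, y) = w (l, y)) \<and> a (l, k) = w (l, k) \<and>
        osc (\<lambda>y. w (l, y)) k \<longlonglongrightarrow> 0"
      using J_good(1)[OF k] by (simp add: good_def)
    then show ?thesis
    proof eventually_elim
      case (elim l)
      then show ?case
        using lebesgue_point_section[of l k] k J_good(2)[OF k] by (auto simp: step_def support_on_def)
    qed
  qed
  have pos: "\<not> (AE l in lebI. w (l, k) = 0)" if "k \<in> J" for k
  proof
    assume "AE l in lebI. w (l, k) = 0"
    then have "vertex_degree w k = 0"
      unfolding vertex_degree_def sym[of k] by (rule integral_eq_zero_AE)
    then show False using J_good(1)[OF that] by (simp add: good_def)
  qed
  have reach: "step\<^sup>*\<^sup>* i j"
    if i: "i \<in> J" "AE y in lebI. a (i, y) = w (i, y)" "AE k in lebI. osc (\<lambda>y. w (i, y)) k \<longlonglongrightarrow> 0"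
      and j: "j \<in> J" for i j
  proof -
    \<comment> \<open>The first set uses the edges from the single vertex \<open>i\<close>, which as
      a null set has no in-flow to contribute. Afterwards in-flow integrals replace existence of an
      edge, since they depend measurably on \<open>k\<close>.\<close>
    define T where "T = rec_nat {k. step i k} (\<lambda>_ A. {k \<in> J. 0 < (LINT l|lebI. indicator A l * w (l, k))})"
    have T_0: "T 0 = {k. step i k}"
      and T_Suc: "T (Suc n) = {k \<in> J. 0 < (LINT l|lebI. indicator (T n) l * w (l, k))}" for n
      by (simp_all add: T_def)
    have step_i: "AE k in lebI. step i k \<longleftrightarrow> w (i, k) \<noteq> 0"
      using J i(2,3)
    proof eventually_elim
      case (elim k)
      then show ?case
        using lebesgue_point_section[OF i(2), of k] J_good(2)[of k] by (auto simp: step_def support_on_def)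
    qed
    have T_sets: "T n \<in> sets lebI" for n
    proof (induction n)
      case 0
      have 1: "{k \<in> space lebI. w (i, k) \<noteq> 0} \<in> sets lebI" by measurable
      \<comment> \<open>\<open>T 0\<close> is defined through \<open>a\<close>; it is measurable
        because it differs from a Borel condition on \<open>w\<close> by a null set and
        \<open>lebI\<close> is complete.\<close>
      have 2: "AE k in lebI. k \<in> {k \<in> space lebI. w (i, k) \<noteq> 0} \<longleftrightarrow> k \<in> T 0"
        using step_i I by eventually_elim (simp add: T_0)
      show ?case
        by (rule lebI.in_sets_AE[OF 2 1]) (use J_good(2) in \<open>auto simp: T_0 step_def\<close>)
    next
      case (Suc n)
      then have [measurable]: "T n \<in> sets lebI" .
      have "(\<lambda>k. LINT l|lebI. indicator (T n) l * w (l, k)) \<in> borel_measurable lebI"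
        by measurable
      then have "{k \<in> space lebI. 0 < (LINT l|lebI. indicator (T n) l * w (l, k))} \<inter> J \<in> sets lebI"
        using J_sets by measurable
      moreover have "{k \<in> space lebI. 0 < (LINT l|lebI. indicator (T n) l * w (l, k))} \<inter> J = T (Suc n)"
        using J_good(2) by (auto simp: T_Suc)
      ultimately show ?case by simp
    qed
    have T_reach: "k \<in> T n \<Longrightarrow> step\<^sup>*\<^sup>* i k" for n k
    proof (induction n arbitrary: k)
      case 0
      then show ?case by (auto simp: T_0)
    next
      case (Suc n)
      \<comment> \<open>Almost every \<open>l\<close> with \<open>w (l, k) \<noteq> 0\<close> has an
        edge to \<open>k\<close>. If none of these lay in \<open>T n\<close>, the in-flow from
        \<open>T n\<close> would be zero.\<close>
      have "\<exists>l\<in>T n. step l k"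
      proof (rule ccontr)
        assume *: "\<not> ?thesis"
        have "k \<in> J" using Suc.prems by (simp add: T_Suc)
        then have "AE l in lebI. indicator (T n) l * w (l, k) = 0"
          by (rule AE_mp[OF step AE_I2]) (use * in \<open>auto simp: indicator_def\<close>)
        then have "(LINT l|lebI. indicator (T n) l * w (l, k)) = 0" by (rule integral_eq_zero_AE)
        with Suc.prems show False by (simp add: T_Suc)
      qed
      then show ?case using Suc.IH by (meson rtranclp.rtrancl_into_rtrancl)
    qed
    define C where "C = {0..1} - (\<Union>n. T n)"
    have "C \<in> sets lebI"
      using sets.compl_sets[OF sets.countable_UN[of T UNIV lebI]] T_sets by (auto simp: C_def)
    moreover have "AE k in lebI. AE l in lebI. k \<in> C \<longrightarrow> l \<notin> C \<longrightarrow> w (k, l) = 0"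
      using J
    proof eventually_elim
      case (elim k)
      show ?case
      proof (cases "k \<in> C")
        case True
        \<comment> \<open>A point of \<open>J\<close> outside all the \<open>T n\<close> lies in no
          \<open>T (Suc n)\<close>, so it receives no mass from any \<open>T n\<close>; by symmetry
          it sends none there.\<close>
        have "AE l in lebI. indicator (T n) l * w (l, k) = 0" for n
        proof -
          have "integrable lebI (\<lambda>l. indicator (T n) l * w (l, k))"
            using integrable_section[of k] T_sets[of n] unfolding sym[of k]
            by (intro integrable_lebI_indicator) (auto simp: sets_lebI_iff)
          moreover have "\<not> 0 < (LINT l|lebI. indicator (T n) l * w (l, k))"
            using True elim T_Suc[of n] by (auto simp: C_def)
          moreover have "0 \<le> (LINT l|lebI. indicator (T n) l * w (l, k))"
            by (intro integral_nonneg_AE AE_I2) (simp add: nonneg)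
          ultimately show ?thesis
            using integral_nonneg_eq_0_iff_AE[of lebI "\<lambda>l. indicator (T n) l * w (l, k)"]
            by (simp add: nonneg)
        qed
        then have "AE l in lebI. \<forall>n. indicator (T n) l * w (l, k) = 0" unfolding AE_all_countable ..
        with I show ?thesis
        proof eventually_elim
          case (elim l)
          then show ?case using sym[of k l] by (auto simp: C_def indicator_def split: if_splits)
        qed
      qed simp
    qed
    ultimately have cases: "(AE k in lebI. k \<in> C) \<or> (AE k in lebI. k \<notin> C)"
      using irr unfolding irreducible_kernel_def by blast
    \<comment> \<open>The positive degree of \<open>i\<close> gives \<open>T 0\<close> positive
      measure.\<close>
    have "\<not> (AE k in lebI. k \<in> C)"
    proof
      assume "AE k in lebI. k \<in> C"
      then have "AE k in lebI. w (k, i) = 0"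
        using step_i
      proof eventually_elim
        case (elim k)
        then have "k \<notin> T 0" by (auto simp: C_def)
        with elim show ?case by (simp add: T_0 sym[of k])
      qed
      with pos[OF i(1)] show False by simp
    qed
    with cases have "AE l in lebI. l \<notin> C" by simp
    with step[OF j] I have AE_l: "AE l in lebI. (w (l, j) \<noteq> 0 \<longrightarrow> step l j) \<and> l \<in> (\<Union>n. T n)"
      by eventually_elim (simp add: C_def)
    \<comment> \<open>Since \<open>j\<close> has positive degree and almost every point is reached,
      some reached \<open>l\<close> has an edge to \<open>j\<close>, which closes the chain.\<close>
    obtain l where "w (l, j) \<noteq> 0" "step l j" "l \<in> (\<Union>n. T n)"
      using AE_witness[OF AE_l pos[OF j]] by blast
    then show "step\<^sup>*\<^sup>* i j" using T_reach by (auto intro: rtranclp.rtrancl_into_rtrancl)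
  qed
  have "chain_connected_on J a"
    unfolding chain_connected_on_def J_def AE_lebesgue_on_Diff_null[OF N]
    unfolding J_def[symmetric]
    using J section_eq AE_osc_section
  proof eventually_elim
    case (elim i)
    show ?case
    proof (intro ballI impI)
      fix j assume "j \<in> J - {i}"
      then have "step\<^sup>*\<^sup>* i j" using reach elim by blast
      from chain_if_rtranclp[OF this \<open>i \<in> J\<close>]
      show "\<exists>m\<ge>1. \<exists>l :: nat \<Rightarrow> real. (\<forall>k \<in> {1..m}. l k \<in> J) \<and> l 1 = i \<and> l m = j \<and>
         (\<forall>k \<in> {1..<m}. l (k + 1) \<in> support_on {0..1} (\<lambda>y. a (l k, y)) \<and>
                         lebesgue_point (\<lambda>y. a (l k, y)) (l (k + 1)))"
        unfolding step_def by blast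
    qed
  qed
  then show ?thesis
    using N by (intro bexI[of _ N]) (auto simp: J_def N_def)
qed

end

section \<open>Symmetric Borel version of the kernel\<close>

text \<open>The exceptional set is covered by a Borel null set of the plane. Its sections are null
  by Fubini, and a Borel set is measurable for \<open>lebII\<close>, so Fubini there returns a null
  set of the product.\<close>

lemma AE_lebII_if_AE_lborel:
  assumes "AE p in lborel :: (real \<times> real) measure. p \<in> {0..1} \<times> {0..1} \<longrightarrow> P p"
  shows "AE p in lebII. P p"
proof -
  have AE_lebI: "AE x in lebI. Q x" if "AE x in lborel. Q x" for Q :: "real \<Rightarrow> bool"
    using AE_completion[OF that] by (subst AE_restrict_space_iff) auto
  obtain Z where Z: "Z \<in> null_sets (lborel :: (real \<times> real) measure)"
    "{p. \<not> (p \<in> {0..1} \<times> {0..1} \<longrightarrow> P p)} \<subseteq> Z"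
    using assms by (auto simp: eventually_ae_filter)
  then have Zb: "Z \<in> sets borel" by auto
  have "AE p in lborel \<Otimes>\<^sub>M lborel. p \<notin> Z"
    unfolding lborel_prod by (rule AE_not_in[OF Z(1)])
  then have "AE x in lborel. AE y in lborel. (x, y) \<notin> Z"
    by (rule lborel_pair.AE_pair)
  then have "AE x in lebI. AE y in lborel. (x, y) \<notin> Z" by (rule AE_lebI)
  then have sections: "AE x in lebI. AE y in lebI. (x, y) \<notin> Z"
    by eventually_elim (rule AE_lebI)
  have "(\<lambda>p. indicator Z p :: real) \<in> borel_measurable lebII"
    using Zb by (intro borel_measurable_lebII borel_measurable_indicator)
  then have "{p \<in> space lebII. \<not> indicator Z p > (0::real)} \<in> sets lebII" by measurable
  then have "{p \<in> space lebII. (fst p, snd p) \<notin> Z} \<in> sets lebII"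
    by (simp add: indicator_def)
  then have "AE p in lebII. (fst p, snd p) \<notin> Z"
    using sections by (subst lebI2.AE_pair_iff[symmetric])
  then show ?thesis
    by (rule AE_mp[OF _ AE_I2]) (use Z(2) in auto)
qed

text \<open>The hypothesis is the self-adjointness of the integral operator, tested on indicator functions.\<close>

lemma AE_symmetric_if_rectangles:
  assumes g [measurable]: "g \<in> borel_measurable lebII" and range: "\<And>p. g p \<in> {0..1::real}"
    and rect: "\<And>A B. A \<in> sets lebI \<Longrightarrow> B \<in> sets lebI \<Longrightarrow>
      (LINT i|lebI. indicator B i * (LINT j|lebI. g (i, j) * indicator A j))
      = (LINT i|lebI. indicator A i * (LINT j|lebI. g (i, j) * indicator B j))"
  shows "AE p in lebII. g p = g (snd p, fst p)"
proof -
  let ?g' = "\<lambda>p. g (snd p, fst p)"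
  have g' [measurable]: "?g' \<in> borel_measurable lebII"
    by (rule measurable_compose[of "\<lambda>p. (snd p, fst p)" lebII lebII]) measurable
  have int: "integrable lebII (\<lambda>p. g p * indicator (A \<times> B) p)"
    if [measurable]: "A \<in> sets lebI" "B \<in> sets lebI" for A B
    using range by (intro lebI2.integrable_const_bound[where B = 1]) (auto simp: indicator_def)
  have fubini: "(LINT p|lebII. g p * indicator (A \<times> B) p)
      = (LINT i|lebI. indicator A i * (LINT j|lebI. g (i, j) * indicator B j))"
    if "A \<in> sets lebI" "B \<in> sets lebI" for A B
  proof -
    have "(LINT p|lebII. g p * indicator (A \<times> B) p)
        = (LINT i|lebI. LINT j|lebI. g (i, j) * indicator (A \<times> B) (i, j))"
      by (rule lebI2.integral_fst'[OF int[OF that], symmetric])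
    also have "\<dots> = (LINT i|lebI. indicator A i * (LINT j|lebI. g (i, j) * indicator B j))"
      by (intro Bochner_Integration.integral_cong) (auto simp: indicator_times indicator_def)
    finally show ?thesis .
  qed
  have eq_int: "(LINT p|lebII. ?g' p * indicator (A \<times> B) p) = (LINT p|lebII. g p * indicator (A \<times> B) p)"
    and int': "integrable lebII (\<lambda>p. ?g' p * indicator (A \<times> B) p)"
    if A [measurable]: "A \<in> sets lebI" and B [measurable]: "B \<in> sets lebI" for A B
  proof -
    have swap: "?g' p * indicator (A \<times> B) p = (\<lambda>(x, y). g (y, x) * indicator (B \<times> A) (y, x)) p" for p
      by (cases p) (auto simp: indicator_def)
    show "integrable lebII (\<lambda>p. ?g' p * indicator (A \<times> B) p)"
      unfolding swap using lebI2.integrable_product_swap[OF int[OF B A]] .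
    have "(LINT p|lebII. ?g' p * indicator (A \<times> B) p) = (LINT p|lebII. g p * indicator (B \<times> A) p)"
      unfolding swap by (rule lebI2.integral_product_swap) measurable
    also have "\<dots> = (LINT p|lebII. g p * indicator (A \<times> B) p)"
      unfolding fubini[OF A B] fubini[OF B A] by (rule rect[OF A B])
    finally show "(LINT p|lebII. ?g' p * indicator (A \<times> B) p) = (LINT p|lebII. g p * indicator (A \<times> B) p)" .
  qed
  let ?E = "{A \<times> B | A B. A \<in> sets lebI \<and> B \<in> sets lebI}"
  \<comment> \<open>The measures with densities \<open>g\<close> and its transpose agree on
    rectangles, an intersection-stable generator, hence everywhere; uniqueness of densities yields
    the claim.\<close>
  have "density lebII (\<lambda>p. ennreal (g p)) = density lebII (\<lambda>p. ennreal (?g' p))"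
  proof (rule measure_eqI_generator_eq[where E = ?E and \<Omega> = "space lebI \<times> space lebI"
        and A = "\<lambda>_. space lebI \<times> space lebI"])
    show "Int_stable ?E" by (rule Int_stable_pair_measure_generator)
    show "?E \<subseteq> Pow (space lebI \<times> space lebI)" by (rule pair_measure_closed)
    show "sets (density lebII (\<lambda>p. ennreal (g p))) = sigma_sets (space lebI \<times> space lebI) ?E"
      "sets (density lebII (\<lambda>p. ennreal (?g' p))) = sigma_sets (space lebI \<times> space lebI) ?E"
      by (simp_all add: sets_pair_measure)
    have emeasure: "emeasure (density lebII (\<lambda>p. ennreal (h p))) (A \<times> B)
        = ennreal (LINT p|lebII. h p * indicator (A \<times> B) p)"
      if [measurable]: "A \<in> sets lebI" "B \<in> sets lebI" "h \<in> borel_measurable lebII" and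
        h: "integrable lebII (\<lambda>p. h p * indicator (A \<times> B) p)" "\<And>p. 0 \<le> h p" for A B h
    proof -
      have "emeasure (density lebII (\<lambda>p. ennreal (h p))) (A \<times> B)
          = (\<integral>\<^sup>+ p. ennreal (h p * indicator (A \<times> B) p) \<partial>lebII)"
        by (subst emeasure_density) (auto intro!: nn_integral_cong simp: indicator_def)
      then show ?thesis
        using h by (subst (asm) nn_integral_eq_integral) auto
    qed
    show "emeasure (density lebII (\<lambda>p. ennreal (g p))) X = emeasure (density lebII (\<lambda>p. ennreal (?g' p))) X"
      if XE: "X \<in> ?E" for X
    proof -
      obtain A B where X: "X = A \<times> B" and A: "A \<in> sets lebI" and B: "B \<in> sets lebI"
        using XE by blast
      show ?thesis
        unfolding X using emeasure[OF A B g int[OF A B]] emeasure[OF A B g' int'[OF A B]] eq_int[OF A B] range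
        by simp
    qed
    show "range (\<lambda>_. space lebI \<times> space lebI) \<subseteq> ?E" by blast
    have "emeasure (density lebII (\<lambda>p. ennreal (g p))) (space lebI \<times> space lebI)
        = ennreal (LINT p|lebII. g p * indicator (space lebI \<times> space lebI) p)"
      using range by (intro emeasure int g sets.top) auto
    then show "emeasure (density lebII (\<lambda>p. ennreal (g p))) (space lebI \<times> space lebI) \<noteq> \<infinity>" for i :: nat
      by simp
  qed simp
  then have "AE p in lebII. ennreal (g p) = ennreal (?g' p)"
    by (intro lebI2.density_unique) auto
  then show ?thesis
    by eventually_elim (use range in \<open>simp add: ennreal_inj\<close>)
qed

lemma indicator_axis_L2I:
  assumes A: "A \<in> sets lebI"
  shows "(\<lambda>i. indicator A i *\<^sub>R axis k (1::real)) \<in> (L2I :: (real \<Rightarrow> real ^ 'd) set)"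
proof -
  have sq: "(norm (indicator A i *\<^sub>R axis k (1::real) :: real ^ 'd))\<^sup>2 = indicator A i" for i
    by (simp add: norm_axis_1 indicator_def)
  show ?thesis
    unfolding L2I_def mem_Collect_eq sq using A lebI_indicator(1)[OF A] by simp
qed

text \<open>A Borel version of \<open>a\<close>, extended by zero, is truncated and then
  symmetrised. Self-adjointness shows that neither correction changes it on the unit square beyond a
  null set of \<open>lebII\<close>.\<close>

lemma kernel_version_exists:
  fixes a :: "real \<times> real \<Rightarrow> real"
  assumes a: "a \<in> borel_measurable (lebesgue_on ({0..1} \<times> {0..1}))"
    and range: "AE p in lebesgue_on ({0..1} \<times> {0..1}). a p \<in> {0..1}"
    and sym: "symmetric_op (adjacency a :: (real \<Rightarrow> real ^ 'd) \<Rightarrow> real \<Rightarrow> real ^ 'd)"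
  obtains w where "kernel_version w a"
proof -
  have II: "{0..1} \<times> {0..1} \<in> sets (lebesgue :: (real \<times> real) measure)"
    using borel_closed[OF closed_Times[OF closed_atLeastAtMost closed_atLeastAtMost, of "0::real" 1 "0::real" 1]]
    by (intro sets_completionI_sets) simp
  have "(\<lambda>p. indicator ({0..1} \<times> {0..1}) p *\<^sub>R a p) \<in> borel_measurable lebesgue"
    using a II by (subst (asm) borel_measurable_restrict_space_iff) auto
  then obtain f where f [measurable]: "f \<in> borel_measurable lborel"
    and f_eq: "AE p in lborel. indicator ({0..1} \<times> {0..1}) p *\<^sub>R a p = f p"
    using completion_ex_borel_measurable_real by blast
  have "AE p in lborel. p \<in> {0..1} \<times> {0..1} \<longrightarrow> a p \<in> {0..1}"
    using range II by (subst (asm) AE_restrict_space_iff) (auto simp: AE_completion_iff)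
  with f_eq have "AE p in lborel. p \<in> {0..1} \<times> {0..1} \<longrightarrow> a p = max 0 (min 1 (f p))"
    by eventually_elim auto
  then have a_eq: "AE p in lebII. a p = max 0 (min 1 (f p))"
    by (rule AE_lebII_if_AE_lborel)
  \<comment> \<open>Truncation turns the range condition on \<open>a\<close>, known almost
    everywhere, into one that holds at every point.\<close>
  define g where "g p = max 0 (min 1 (f p))" for p
  have g_borel: "g \<in> borel_measurable borel" unfolding g_def using f by simp
  have g [measurable]: "g \<in> borel_measurable lebII" by (rule borel_measurable_lebII[OF g_borel])
  have g_range: "g p \<in> {0..1}" for p by (simp add: g_def)
  have sections: "AE i in lebI. AE j in lebI. a (i, j) = g (i, j)"
    using lebI2.AE_pair[OF a_eq] by (simp add: g_def)
  have section_meas: "(\<lambda>j. g (i, j)) \<in> borel_measurable lebI" for i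
  proof (rule borel_measurable_lebI, rule measurable_compose[OF _ g_borel])
    show "(\<lambda>j. (i, j)) \<in> borel_measurable borel"
      by (intro borel_measurable_continuous_onI continuous_intros)
  qed
  \<comment> \<open>The adjacency operator acts coordinatewise, so testing along one arbitrary axis
    recovers the scalar identity for \<open>g\<close>.\<close>
  let ?e = "axis (undefined :: 'd) (1::real)"
  have adj: "AE i in lebI. adjacency a (\<lambda>j. indicator A j *\<^sub>R ?e) i = (LINT j|lebI. g (i, j) * indicator A j) *\<^sub>R ?e"
    if A: "A \<in> sets lebI" for A
    using sections
  proof eventually_elim
    case (elim i)
    have int: "integrable lebI (\<lambda>j. g (i, j) * indicator A j)"
      using section_meas[of i] A g_range[of "(i, _)"]
      by (intro integrable_lebI_bounded[where B = 1]) (auto simp: indicator_def)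
    have "(\<lambda>j. (g (i, j) * indicator A j) *\<^sub>R ?e) \<in> borel_measurable lebI"
      using int by (intro borel_measurable_scaleR) auto
    moreover have "AE j in lebI. (g (i, j) * indicator A j) *\<^sub>R ?e = a (i, j) *\<^sub>R (indicator A j *\<^sub>R ?e)"
      using elim by eventually_elim simp
    ultimately have "(LINT j|lebI. (g (i, j) * indicator A j) *\<^sub>R ?e) = adjacency a (\<lambda>j. indicator A j *\<^sub>R ?e) i"
      unfolding adjacency_def by (rule lebI.integral_cong_AE_left)
    then show ?case using int by simp
  qed
  have meas: "(\<lambda>i. LINT j|lebI. g (i, j) * indicator A j) \<in> borel_measurable lebI" if [measurable]: "A \<in> sets lebI" for A
    by measurable
  have e: "?e \<bullet> ?e = 1" by (simp add: norm_axis_1 flip: power2_norm_eq_inner)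
  have left: "innerL2 (adjacency a (\<lambda>j. indicator A j *\<^sub>R ?e)) (\<lambda>i. indicator B i *\<^sub>R ?e)
      = (LINT i|lebI. indicator B i * (LINT j|lebI. g (i, j) * indicator A j))"
    if A: "A \<in> sets lebI" and B [measurable]: "B \<in> sets lebI" for A B
  proof -
    have "(\<lambda>i. indicator B i * (LINT j|lebI. g (i, j) * indicator A j)) \<in> borel_measurable lebI"
      using meas[OF A] by measurable
    moreover have "AE i in lebI. indicator B i * (LINT j|lebI. g (i, j) * indicator A j)
        = adjacency a (\<lambda>j. indicator A j *\<^sub>R ?e) i \<bullet> (indicator B i *\<^sub>R ?e)"
      using adj[OF A] by eventually_elim (simp add: e)
    ultimately show ?thesis
      unfolding innerL2_def by (rule lebI.integral_cong_AE_left[symmetric])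
  qed
  have right: "innerL2 (\<lambda>i. indicator B i *\<^sub>R ?e) (adjacency a (\<lambda>j. indicator A j *\<^sub>R ?e))
      = (LINT i|lebI. indicator B i * (LINT j|lebI. g (i, j) * indicator A j))"
    if "A \<in> sets lebI" "B \<in> sets lebI" for A B
    using left[OF that] by (simp add: innerL2_def inner_commute)
  have "AE p in lebII. g p = g (snd p, fst p)"
  proof (rule AE_symmetric_if_rectangles[OF g g_range])
    fix A B assume A: "A \<in> sets lebI" and B: "B \<in> sets lebI"
    show "(LINT i|lebI. indicator B i * (LINT j|lebI. g (i, j) * indicator A j))
        = (LINT i|lebI. indicator A i * (LINT j|lebI. g (i, j) * indicator B j))"
      using sym[unfolded symmetric_op_def, rule_format,
          OF indicator_axis_L2I[OF A, of undefined] indicator_axis_L2I[OF B, of undefined]]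
      unfolding left[OF A B] right[OF B A] .
  qed
  \<comment> \<open>Averaging with the transpose upgrades symmetry almost everywhere to symmetry at
    every point.\<close>
  with a_eq have eq: "AE p in lebII. a p = (g p + g (snd p, fst p)) / 2"
    by eventually_elim (simp add: g_def)
  have "kernel_version (\<lambda>p. (g p + g (snd p, fst p)) / 2) a"
  proof
    show "(\<lambda>p. (g p + g (snd p, fst p)) / 2) \<in> borel_measurable borel"
    proof -
      have "(\<lambda>p. (snd p, fst p)) \<in> borel_measurable (borel :: (real \<times> real) measure)"
        by (intro borel_measurable_continuous_onI continuous_intros)
      from measurable_compose[OF this g_borel] show ?thesis using g_borel by simp
    qed
    show "(g p + g (snd p, fst p)) / 2 \<in> {0..1}" for p
      using g_range[of p] g_range[of "(snd p, fst p)"] by auto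
  qed (use eq in \<open>simp_all add: add.commute\<close>)
  then show ?thesis by (rule that)
qed

section \<open>The essential infimum and the final equivalence\<close>

lemma ess_inf_pos_iff: "ess_inf M f > 0 \<longleftrightarrow> (\<exists>\<delta>>0. AE x in M. \<delta> \<le> f x)"
proof
  assume "ess_inf M f > 0"
  then obtain \<delta> where \<delta>: "0 < ereal \<delta>" "ereal \<delta> < ess_inf M f"
    using ereal_dense2 by blast
  have "AE x in M. ereal \<delta> < ereal (f x)"
    using less_LiminfD[OF \<delta>(2)[unfolded ess_inf_def]] .
  then have "AE x in M. \<delta> \<le> f x" by eventually_elim simp
  with \<delta>(1) show "\<exists>\<delta>>0. AE x in M. \<delta> \<le> f x" by (intro exI[of _ \<delta>]) simp
next
  assume "\<exists>\<delta>>0. AE x in M. \<delta> \<le> f x"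
  then obtain \<delta> where \<delta>: "\<delta> > 0" "AE x in M. ereal \<delta> \<le> ereal (f x)" by auto
  have "ereal \<delta> \<le> ess_inf M f" unfolding ess_inf_def by (rule Liminf_bounded[OF \<delta>(2)])
  then show "ess_inf M f > 0" using \<delta>(1) by (intro less_le_trans[OF _ \<open>ereal \<delta> \<le> ess_inf M f\<close>]) simp
qed

theorem theorem5p2:
  fixes a :: "real \<times> real \<Rightarrow> real"
  assumes "a \<in> borel_measurable (lebesgue_on ({0..1} \<times> {0..1}))"
    and "AE p in lebesgue_on ({0..1} \<times> {0..1}). a p \<in> {0..1}"
    and "symmetric_op (adjacency a :: (real \<Rightarrow> real ^ 'd) \<Rightarrow> real \<Rightarrow> real ^ 'd)"
  shows "strongly_connected a \<longleftrightarrow>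
    lambda2 (graph_laplacian a :: (real \<Rightarrow> real ^ 'd) \<Rightarrow> real \<Rightarrow> real ^ 'd) > 0"
proof -
  obtain w where "kernel_version w a"
    using kernel_version_exists[OF assms] .
  then interpret kernel_version w a .
  have "strongly_connected a \<longleftrightarrow>
    (\<forall>N\<^sub>0 \<in> null_sets lebesgue. \<exists>N \<in> null_sets lebesgue. N\<^sub>0 \<subseteq> N \<and> chain_connected_on ({0..1} - N) a) \<and>
    (\<exists>\<delta>>0. AE i in lebI. \<delta> \<le> vertex_degree a i)"
    by (simp add: strongly_connected_def ess_inf_pos_iff vertex_degree_def)
  also have "(\<exists>\<delta>>0. AE i in lebI. \<delta> \<le> vertex_degree a i) \<longleftrightarrow> (\<exists>\<delta>>0. AE i in lebI. \<delta> \<le> vertex_degree w i)"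
  proof -
    have "(AE i in lebI. \<delta> \<le> vertex_degree a i) \<longleftrightarrow> (AE i in lebI. \<delta> \<le> vertex_degree w i)" for \<delta>
      using degree_eq by (intro eventually_subst) (auto elim: eventually_mono)
    then show ?thesis by simp
  qed
  \<comment> \<open>The degree condition passes to \<open>w\<close>, while the chain condition stays
    with \<open>a\<close> because it inspects values at individual points.\<close>
  finally have sc: "strongly_connected a \<longleftrightarrow>
    (\<forall>N\<^sub>0 \<in> null_sets lebesgue. \<exists>N \<in> null_sets lebesgue. N\<^sub>0 \<subseteq> N \<and> chain_connected_on ({0..1} - N) a) \<and>
    (\<exists>\<delta>>0. AE i in lebI. \<delta> \<le> vertex_degree w i)" .
  show ?thesis
  proof
    assume "strongly_connected a"
    then have chain: "\<And>N\<^sub>0. N\<^sub>0 \<in> null_sets lebesgue \<Longrightarrow>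
        \<exists>N \<in> null_sets lebesgue. N\<^sub>0 \<subseteq> N \<and> chain_connected_on ({0..1} - N) a"
      and "\<exists>\<delta>>0. AE i in lebI. \<delta> \<le> vertex_degree w i"
      by (simp_all add: sc)
    then obtain \<delta> where "\<delta> > 0" "AE i in lebI. \<delta> \<le> vertex_degree w i" by blast
    moreover have "irreducible_kernel w"
      by (rule irreducible_kernel_if_chain_connected) (rule chain)
    ultimately show "lambda2 (graph_laplacian a :: (real \<Rightarrow> real ^ 'd) \<Rightarrow> _) > 0"
      unfolding lambda2_eq
      by (intro lambda2_pos_if_irreducible)
  next
    assume pos: "lambda2 (graph_laplacian a :: (real \<Rightarrow> real ^ 'd) \<Rightarrow> _) > 0"
    note irr = irreducible_kernel_if_lambda2_pos[OF pos[unfolded lambda2_eq]]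
    note deg = degree_bound_if_lambda2_pos[OF pos[unfolded lambda2_eq]]
    then have "AE i in lebI. 0 < vertex_degree w i"
      by (auto elim!: eventually_mono)
    then show "strongly_connected a"
      using chain_connected_if_irreducible[OF irr] deg by (simp add: sc)
  qed
qed

end
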